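(* Let $\mathcal{X}\subseteq\mathbb{R}^d$ be compact, $c\ge2$ an integer, and let $\mathcal{S}=\{(\mathbf{x}_i,y_i)\}_{i=1}^n$ be i.i.d. samples from an arbitrary joint distribution $P_{XY}$ on $\mathcal{X}\times\{1,\dots,c\}$. Let $S\colon\mathcal{X}\times\mathcal{X}\to[0,1]$ be symmetric and continuous, and assume that the eigenvalues $\lambda_k$ and orthonormal eigenfunctions $\phi_k$ of the integral operator $(L_Sf)(\mathbf{x})=\int S(\mathbf{x},\mathbf{t})f(\mathbf{t})\,d\mathbf{t}$ satisfy $\sum_{k\ge1}\lambda_k|\phi_k(\mathbf{x})|^2<C$ for all $\mathbf{x}\in\mathcal{X}$ and some constant $C>0$; let $S^{+}(\mathbf{x},\mathbf{t})=\sum_{k:\lambda_k\ge0}\lambda_k\phi_k(\mathbf{x})\phi_k(\mathbf{t})$ and $S^{-}(\mathbf{x},\mathbf{t})=\sum_{k:\lambda_k<0}|\lambda_k|\phi_k(\mathbf{x})\phi_k(\mathbf{t})$ (so that $S=S^+-S^-$). Let $\boldsymbol{\alpha}=(\alpha_1,\dots,\alpha_n)^\top$ with $\boldsymbol{\alpha}\ge0$, $\mathbf{1}^\top\boldsymbol{\alpha}=1$, define $h_S(\mathbf{x},y)=\sum_{i:y_i=y}\alpha_iS(\mathbf{x},\mathbf{x}_i)$ and the classifier $f_S(\mathbf{x})=\arg\max_{y\in\{1,\dots,c\}}h_S(\mathbf{x},y)$. Let $B^+,B^-,R>0$ be constants and suppose $\Omega^{+}(\boldsymbol{\alpha})\le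 (B^{+})^2$, $\Omega^{-}(\boldsymbol{\alpha})\le (B^{-})^2$, $\sup_{\mathbf{x}\in\mathcal{X}}|S^{+}(\mathbf{x},\mathbf{x})|\le R^2$ and $\sup_{\mathbf{x}\in\mathcal{X}}|S^{-}(\mathbf{x},\mathbf{x})|\le R^2$. Let $\gamma>0$ and $\delta\in(0,1)$. Then with probability at least $1-\delta$ over $\mathcal{S}$, $$R(f_S)=\Pr[Y\neq f_S(X)]\le \hat R_n(f_S)+\frac{8R(2c-1)c(B^++B^-)}{\gamma\sqrt n}+\Big(\frac{16c(2c-1)(B^++B^-)R^2}{\gamma}+1\Big)\sqrt{\frac{\log(4/\delta)}{2n}},$$ where $\hat R_n(f_S)=\frac1n\sum_{i=1}^n\Phi\Big(\frac{h_S(\mathbf{x}_i,y_i)-\max_{y'\neq y_i}h_S(\mathbf{x}_i,y')}{\gamma}\Big)$ and $\Phi(x)=\min\{1,\max\{0,1-x\}\}$. Moreover, if $\gamma\ge1$, then $$\hat R_n(f_S)\le 1-\frac{1}{n\gamma}\sum_{i,j=1}^n\frac{\alpha_i+\alpha_j}{2}S(\mathbf{x}_i,\mathbf{x}_j)+\frac{1}{n\gamma}\sum_{1\le i<j\le n}2(\alpha_i+\alpha_j)S(\mathbf{x}_i,\mathbf{x}_j)\mathbb{1}_{y_i\neq y_j}.$$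
   Context: For $y\in\{1,\dots,c\}$, $\boldsymbol{\alpha}^{(y)}\in\mathbb{R}^n$ has entries $\alpha^{(y)}_i=\alpha_i$ if $y_i=y$ and $0$ otherwise. $\mathbf{S}^{+},\mathbf{S}^{-}\in\mathbb{R}^{n\times n}$ are the Gram matrices $[\mathbf{S}^{\pm}]_{ij}=S^{\pm}(\mathbf{x}_i,\mathbf{x}_j)$, and $\Omega^{+}(\boldsymbol{\alpha})=\sum_{y=1}^c{\boldsymbol{\alpha}^{(y)}}^\top\mathbf{S}^{+}\boldsymbol{\alpha}^{(y)}$, $\Omega^{-}(\boldsymbol{\alpha})=\sum_{y=1}^c{\boldsymbol{\alpha}^{(y)}}^\top\mathbf{S}^{-}\boldsymbol{\alpha}^{(y)}$. $\mathbb{1}_E$ is $1$ if $E$ holds and $0$ otherwise. *)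

theory Defs
  imports "HOL-Probability.Probability"
begin

text \<open>Positive / negative parts of the kernel via its eigen-expansion, indexed by the
  set K of eigen-indices.\<close>
definition Splus :: "(nat \<Rightarrow> real) \<Rightarrow> (nat \<Rightarrow> 'a \<Rightarrow> real) \<Rightarrow> nat set \<Rightarrow> 'a \<Rightarrow> 'a \<Rightarrow> real" where
  "Splus lam phi K x t = (\<Sum>k. if k \<in> K \<and> lam k \<ge> 0 then lam k * phi k x * phi k t else 0)"

definition Sminus :: "(nat \<Rightarrow> real) \<Rightarrow> (nat \<Rightarrow> 'a \<Rightarrow> real) \<Rightarrow> nat set \<Rightarrow> 'a \<Rightarrow> 'a \<Rightarrow> real" where
  "Sminus lam phi K x t = (\<Sum>k. if k \<in> K \<and> lam k < 0 then \<bar>lam k\<bar> * phi k x * phi k t else 0)"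

definition hS :: "('a \<Rightarrow> 'a \<Rightarrow> real) \<Rightarrow> (nat \<Rightarrow> real) \<Rightarrow> nat \<Rightarrow> (nat \<Rightarrow> 'a \<times> nat) \<Rightarrow> 'a \<Rightarrow> nat \<Rightarrow> real" where
  "hS S \<alpha> n s x y = (\<Sum>i<n. if snd (s i) = y then \<alpha> i * S x (fst (s i)) else 0)"

definition fS :: "nat \<Rightarrow> ('a \<Rightarrow> 'a \<Rightarrow> real) \<Rightarrow> (nat \<Rightarrow> real) \<Rightarrow> nat \<Rightarrow> (nat \<Rightarrow> 'a \<times> nat) \<Rightarrow> 'a \<Rightarrow> nat" where
  "fS c S \<alpha> n s x = (LEAST y. y \<in> {1..c} \<and> (\<forall>y'\<in>{1..c}. hS S \<alpha> n s x y' \<le> hS S \<alpha> n s x y))"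

definition Phi :: "real \<Rightarrow> real" where
  "Phi u = min 1 (max 0 (1 - u))"

definition emp_margin_risk :: "nat \<Rightarrow> real \<Rightarrow> ('a \<Rightarrow> 'a \<Rightarrow> real) \<Rightarrow> (nat \<Rightarrow> real) \<Rightarrow> nat \<Rightarrow> (nat \<Rightarrow> 'a \<times> nat) \<Rightarrow> real" where
  "emp_margin_risk c \<gamma> S \<alpha> n s =
     (1 / real n) * (\<Sum>i<n. Phi ((hS S \<alpha> n s (fst (s i)) (snd (s i))
        - Max ((\<lambda>y'. hS S \<alpha> n s (fst (s i)) y') ` ({1..c} - {snd (s i)}))) / \<gamma>))"

text \<open>Omega(alpha) = sum_y alpha^(y)^T G alpha^(y) for the Gram matrix of kernel Sk.\<close>
definition Omega :: "('a \<Rightarrow> 'a \<Rightarrow> real) \<Rightarrow> nat \<Rightarrow> (nat \<Rightarrow> real) \<Rightarrow> nat \<Rightarrow> (nat \<Rightarrow> 'a \<times> nat) \<Rightarrow> real" where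
  "Omega Sk c \<alpha> n s = (\<Sum>y\<in>{1..c}. \<Sum>i<n. \<Sum>j<n.
      (if snd (s i) = y then \<alpha> i else 0) * Sk (fst (s i)) (fst (s j)) * (if snd (s j) = y then \<alpha> j else 0))"

definition true_risk :: "('a \<times> nat) measure \<Rightarrow> ('a \<Rightarrow> nat) \<Rightarrow> real" where
  "true_risk P f = measure P {p \<in> space P. snd p \<noteq> f (fst p)}"

end

theory Submission
  imports Defs
begin

text \<open>
  On \<open>X\<close> the kernel \<open>S\<close> is an indefinite inner product of the features
  \<open>\<psi> k x = sqrt \<bar>lam k\<bar> * phi k x\<close>, so every score \<open>h\<^sub>S(x, y)\<close> is a linear functional of the features
  of \<open>x\<close>, with weight vectors whose total squared length over the labels is
  \<open>\<Omega>\<^sup>+ + \<Omega>\<^sup>- \<le> (Bp + Bm)\<^sup>2\<close>, while the features have squared length at most \<open>2 R\<^sup>2\<close>. The data dependent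
  classifiers therefore lie in one fixed ball of linear multiclass scores, for which a uniform
  margin bound is proved: the largest deviation between true and empirical margin loss concentrates
  around its mean by bounded differences, and the mean is controlled by replacing one sample point
  after the other by a signed perturbation of a direction in weight space. Suprema are taken over
  finite classes only; a countable dense set of finitely supported weights and pointwise limits give
  the whole ball.
\<close>

subsection \<open>Bounded differences\<close>

text \<open>The coefficients \<open>\<alpha>\<close> may be chosen after seeing the sample, so the
  exceptional event must not depend on them; all that is kept of them is a norm bound. The obstacle
  is that the loss reads all c scores through a maximum, whereas contraction is scalar. In the
  scores the loss is \<open>1 / \<gamma>\<close>-Lipschitz for the sum of absolute differences, and
  passing to one label at a time costs a factor c. Each sample point is thus traded for a vector of
  length at most \<open>2 * c * sqrt 2 * R / \<gamma>\<close>. Squared lengths add, so n points give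
  a mean deviation of at most \<open>(Bp + Bm) * sqrt n\<close> times that length, and division by n
  yields the rate \<open>1 / sqrt n\<close>. As the loss lies in [0, 1], changing one point moves
  the n-fold deviation by at most 1, which gives the term
  \<open>sqrt (ln (1 / \<delta>) / (2 * n))\<close>. Both terms are at most those claimed, so the
  constants of the theorem come in only through a final comparison of numbers. The kernel is
  controlled only on \<open>X\<close>; features and limit scores are therefore extended by 0
  outside.\<close>

abbreviation iid :: "'a measure \<Rightarrow> nat \<Rightarrow> (nat \<Rightarrow> 'a) measure" where
  "iid M n \<equiv> PiM {..<n} (\<lambda>_. M)"

context prob_space
begin

lemma prob_space_iid: "prob_space (iid M n)"
  by (rule prob_space_PiM) (rule prob_space_axioms)

lemma space_iid_update:
  assumes "s \<in> space (iid M n)" "z \<in> space M"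
  shows "s(n := z) \<in> space (iid M (Suc n))"
  using assms by (auto simp: space_PiM PiE_iff extensional_def less_Suc_eq)

lemma measurable_iid_update [measurable]:
  "(\<lambda>(z, s). s(n := z)) \<in> measurable (M \<Otimes>\<^sub>M iid M n) (iid M (Suc n))"
  using measurable_compose[OF measurable_pair_swap' measurable_add_dim[of n "{..<n}" "\<lambda>_. M"]]
  by (simp add: lessThan_Suc split_beta')

lemma iid_component_measurable:
  fixes g :: "'a \<Rightarrow> real"
  assumes "g \<in> borel_measurable M" "i < n"
  shows "(\<lambda>s. g (s i)) \<in> borel_measurable (iid M n)"
  using assms by (intro measurable_compose[OF measurable_component_singleton[of i "{..<n}" "\<lambda>_. M"]]) auto

lemma iid_Suc: "distr (M \<Otimes>\<^sub>M iid M n) (iid M (Suc n)) (\<lambda>(z, s). s(n := z)) = iid M (Suc n)"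
  unfolding lessThan_Suc using prob_space_axioms by (intro distr_pair_PiM_eq_PiM) auto

lemma integrable_bounded_real:
  fixes f :: "'a \<Rightarrow> real"
  assumes "f \<in> borel_measurable M" "\<And>x. x \<in> space M \<Longrightarrow> \<bar>f x\<bar> \<le> B"
  shows "integrable M f"
  by (rule integrable_const_bound[of _ B]) (use assms in auto)

text \<open>Fubini in both orders. With the last point innermost, that point can be treated while
  the others are frozen; with it outermost, an induction hypothesis about the first n points becomes
  applicable.\<close>

lemma iid_integral_Suc:
  fixes f :: "(nat \<Rightarrow> 'a) \<Rightarrow> real"
  assumes [measurable]: "f \<in> borel_measurable (iid M (Suc n))"
    and B: "\<And>s. s \<in> space (iid M (Suc n)) \<Longrightarrow> \<bar>f s\<bar> \<le> B"
  shows "(\<integral>s. f s \<partial>iid M (Suc n)) = (\<integral>s. (\<integral>z. f (s(n := z)) \<partial>M) \<partial>iid M n)" (is ?A)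
    and "(\<integral>s. f s \<partial>iid M (Suc n)) = (\<integral>z. (\<integral>s. f (s(n := z)) \<partial>iid M n) \<partial>M)" (is ?B)
proof -
  interpret N: prob_space "iid M n" by (rule prob_space_iid)
  interpret pair: pair_prob_space M "iid M n" ..
  have m: "(\<lambda>(z, s). f (s(n := z))) \<in> borel_measurable (M \<Otimes>\<^sub>M iid M n)"
    using measurable_compose[OF measurable_iid_update assms(1)] by (simp add: split_beta)
  have int: "integrable (M \<Otimes>\<^sub>M iid M n) (\<lambda>(z, s). f (s(n := z)))"
    by (rule pair.P.integrable_bounded_real[OF m, of B])
       (auto simp: space_pair_measure intro!: B space_iid_update)
  have "(\<integral>s. f s \<partial>iid M (Suc n)) = (\<integral>p. (\<lambda>(z, s). f (s(n := z))) p \<partial>(M \<Otimes>\<^sub>M iid M n))"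
    by (subst iid_Suc[symmetric], subst integral_distr) (auto simp: split_beta')
  then show ?A ?B
    using pair.integral_snd[OF int] pair.integral_fst[OF int] by simp_all
qed

text \<open>Hoeffding's lemma wants an interval containing the values. An oscillation of at most
  \<open>c\<close> supplies one, from the infimum \<open>a\<close> to \<open>a + c\<close>; its
  position is irrelevant, since only the length enters the bound.\<close>

lemma Hoeffding_mgf_oscillation:
  fixes g :: "'a \<Rightarrow> real"
  assumes [measurable]: "g \<in> borel_measurable M"
    and osc: "\<And>z z'. z \<in> space M \<Longrightarrow> z' \<in> space M \<Longrightarrow> g z - g z' \<le> c"
  shows "(\<integral>z. exp (g z) \<partial>M) \<le> exp ((\<integral>z. g z \<partial>M) + c\<^sup>2 / 8)"
proof -
  obtain z0 where z0: "z0 \<in> space M"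
    using not_empty by auto
  define a where "a = (INF z\<in>space M. g z)"
  have bdd: "bdd_below (g ` space M)"
    using osc[OF z0] by (intro bdd_belowI2[of _ "g z0 - c"]) (auto simp: algebra_simps)
  have lower: "a \<le> g z" if "z \<in> space M" for z
    unfolding a_def using bdd that by (rule cINF_lower)
  have upper: "g z \<le> a + c" if "z \<in> space M" for z
  proof -
    have "g z - c \<le> a"
      unfolding a_def using z0 osc[OF that] by (intro cINF_greatest) (auto simp: algebra_simps)
    then show ?thesis by simp
  qed
  interpret interval_bounded_random_variable M g a "a + c"
    by unfold_locales (use lower upper in auto)
  define m where "m = (\<integral>z. g z \<partial>M)"
  have int: "integrable M (\<lambda>z. exp (g z - m))"
    by (rule integrable_bounded_real[of _ "exp (a + c - m)"]) (use upper in auto)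
  have "ennreal (\<integral>z. exp (g z - m) \<partial>M) = (\<integral>\<^sup>+z. exp (g z - m) \<partial>M)"
    using int by (subst nn_integral_eq_integral) auto
  also have "\<dots> \<le> ennreal (exp (c\<^sup>2 / 8))"
    using Hoeffdings_lemma_nn_integral[of 1] by (simp add: m_def)
  finally have "(\<integral>z. exp (g z - m) \<partial>M) \<le> exp (c\<^sup>2 / 8)"
    by simp
  moreover have "(\<integral>z. exp (g z) \<partial>M) = exp m * (\<integral>z. exp (g z - m) \<partial>M)"
    by (simp add: exp_diff)
  ultimately show ?thesis
    by (simp add: m_def exp_add)
qed

lemma iid_section_measurable:
  fixes f :: "(nat \<Rightarrow> 'a) \<Rightarrow> real"
  assumes "f \<in> borel_measurable (iid M (Suc n))" "s \<in> space (iid M n)"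
  shows "(\<lambda>z. f (s(n := z))) \<in> borel_measurable M"
  using measurable_compose[OF measurable_component_update[of s "{..<n}" "\<lambda>_. M" n] assms(1)[unfolded lessThan_Suc]] assms(2)
  by simp

lemma iid_marginal_measurable:
  fixes f :: "(nat \<Rightarrow> 'a) \<Rightarrow> real"
  assumes "f \<in> borel_measurable (iid M (Suc n))"
  shows "(\<lambda>s. \<integral>z. f (s(n := z)) \<partial>M) \<in> borel_measurable (iid M n)"
proof -
  have "(\<lambda>(s, z). f (s(n := z))) \<in> borel_measurable (iid M n \<Otimes>\<^sub>M M)"
    using measurable_compose[OF measurable_add_dim[of n "{..<n}" "\<lambda>_. M"] assms[unfolded lessThan_Suc]]
    by (simp add: split_beta')
  then show ?thesis
    by (rule borel_measurable_lebesgue_integral)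
qed

lemma abs_integral_le_bound:
  fixes f :: "'a \<Rightarrow> real"
  assumes "f \<in> borel_measurable M" "\<And>x. x \<in> space M \<Longrightarrow> \<bar>f x\<bar> \<le> B"
  shows "\<bar>\<integral>x. f x \<partial>M\<bar> \<le> B"
proof -
  have "integrable M f"
    using assms by (rule integrable_bounded_real)
  moreover have "-B \<le> f x" "f x \<le> B" if "x \<in> space M" for x
    using assms(2)[OF that] by auto
  ultimately have "-B \<le> (\<integral>x. f x \<partial>M)" "(\<integral>x. f x \<partial>M) \<le> B"
    by (auto intro!: integral_ge_const integral_le_const)
  then show ?thesis by auto
qed

text \<open>Integrating out the last coordinate preserves bounded differences and costs one factor from
  Hoeffding's lemma.\<close>

lemma bounded_differences_mgf:
  fixes f :: "(nat \<Rightarrow> 'a) \<Rightarrow> real"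
  assumes "f \<in> borel_measurable (iid M n)"
    and "\<And>s. s \<in> space (iid M n) \<Longrightarrow> \<bar>f s\<bar> \<le> B"
    and "\<And>s i z. s \<in> space (iid M n) \<Longrightarrow> i < n \<Longrightarrow> z \<in> space M \<Longrightarrow> \<bar>f (s(i := z)) - f s\<bar> \<le> c"
  shows "(\<integral>s. exp (f s) \<partial>iid M n) \<le> exp ((\<integral>s. f s \<partial>iid M n) + real n * c\<^sup>2 / 8)"
  using assms
proof (induction n arbitrary: f)
  case 0
  interpret N: prob_space "iid M 0" by (rule prob_space_iid)
  \<comment> \<open>The product over no index has a single point, the function that is
    \<open>undefined\<close> everywhere, so \<open>f\<close> is constant.\<close>
  have "(\<integral>s. exp (f s) \<partial>iid M 0) = (\<integral>s. exp (f (\<lambda>_. undefined)) \<partial>iid M 0)"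
    by (intro Bochner_Integration.integral_cong) (auto simp: space_PiM)
  moreover have "(\<integral>s. f s \<partial>iid M 0) = (\<integral>s. f (\<lambda>_. undefined) \<partial>iid M 0)"
    by (intro Bochner_Integration.integral_cong) (auto simp: space_PiM)
  ultimately show ?case
    using N.prob_space by simp
next
  case (Suc n)
  interpret N: prob_space "iid M n" by (rule prob_space_iid)
  note meas [measurable] = Suc.prems(1)
  define g where "g = (\<lambda>s. \<integral>z. f (s(n := z)) \<partial>M)"
  have sec: "(\<lambda>z. f (s(n := z))) \<in> borel_measurable M" if "s \<in> space (iid M n)" for s
    using iid_section_measurable[OF meas that] .
  have bd: "\<bar>f (s(n := z))\<bar> \<le> B" if "s \<in> space (iid M n)" "z \<in> space M" for s z
    using Suc.prems(2) space_iid_update[OF that] .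
  have int: "integrable M (\<lambda>z. f (s(n := z)))" if "s \<in> space (iid M n)" for s
    by (rule integrable_bounded_real[OF sec[OF that] bd[OF that]])
  have g_meas [measurable]: "g \<in> borel_measurable (iid M n)"
    unfolding g_def by (rule iid_marginal_measurable[OF meas])
  have g_bd: "\<bar>g s\<bar> \<le> B" if "s \<in> space (iid M n)" for s
    unfolding g_def using that by (intro abs_integral_le_bound sec bd)
  have g_diff: "\<bar>g (s(i := z)) - g s\<bar> \<le> c"
    if s: "s \<in> space (iid M n)" and i: "i < n" and z: "z \<in> space M" for s i z
  proof -
    have s': "s(i := z) \<in> space (iid M n)"
      using s i z by (auto simp: space_PiM PiE_iff extensional_def)
    have "g (s(i := z)) - g s = (\<integral>x. f (s(i := z, n := x)) - f (s(n := x)) \<partial>M)"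
      unfolding g_def using int[OF s] int[OF s'] by simp
    also have "\<bar>\<dots>\<bar> \<le> c"
    proof (rule abs_integral_le_bound)
      show "(\<lambda>x. f (s(i := z, n := x)) - f (s(n := x))) \<in> borel_measurable M"
        using sec[OF s] sec[OF s'] by measurable
      show "\<bar>f (s(i := z, n := x)) - f (s(n := x))\<bar> \<le> c" if "x \<in> space M" for x
      proof -
        have "s(n := x, i := z) = s(i := z, n := x)"
          using i by (intro fun_upd_twist) auto
        moreover have "\<bar>f (s(n := x, i := z)) - f (s(n := x))\<bar> \<le> c"
          using i z by (intro Suc.prems(3) space_iid_update s that) auto
        ultimately show ?thesis by metis
      qed
    qed
    finally show ?thesis .
  qed
  have inner: "(\<integral>z. exp (f (s(n := z))) \<partial>M) \<le> exp (g s) * exp (c\<^sup>2 / 8)" if s: "s \<in> space (iid M n)" for s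
  proof -
    \<comment> \<open>The oscillation in the last coordinate is the bounded difference at
      \<open>s(n := z')\<close> when index \<open>n\<close> is overwritten once more.\<close>
    have "f (s(n := z)) - f (s(n := z')) \<le> c" if "z \<in> space M" "z' \<in> space M" for z z'
    proof -
      have "\<bar>f (s(n := z', n := z)) - f (s(n := z'))\<bar> \<le> c"
        using that by (intro Suc.prems(3) space_iid_update s) auto
      then have "\<bar>f (s(n := z)) - f (s(n := z'))\<bar> \<le> c"
        by (metis fun_upd_upd)
      then show ?thesis by linarith
    qed
    from Hoeffding_mgf_oscillation[OF sec[OF s] this] show ?thesis
      by (simp add: g_def exp_add)
  qed
  have e_bd: "\<bar>exp (f s)\<bar> \<le> exp B" if "s \<in> space (iid M (Suc n))" for s
    using Suc.prems(2)[OF that] by auto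
  have "(\<integral>s. exp (f s) \<partial>iid M (Suc n)) = (\<integral>s. (\<integral>z. exp (f (s(n := z))) \<partial>M) \<partial>iid M n)"
    by (rule iid_integral_Suc(1)[OF _ e_bd]) measurable
  also have "\<dots> \<le> (\<integral>s. exp (g s) * exp (c\<^sup>2 / 8) \<partial>iid M n)"
  proof (rule integral_mono)
    show "integrable (iid M n) (\<lambda>s. \<integral>z. exp (f (s(n := z))) \<partial>M)"
    proof (rule N.integrable_bounded_real)
      show "(\<lambda>s. \<integral>z. exp (f (s(n := z))) \<partial>M) \<in> borel_measurable (iid M n)"
        by (rule iid_marginal_measurable) measurable
      show "\<bar>\<integral>z. exp (f (s(n := z))) \<partial>M\<bar> \<le> exp B" if "s \<in> space (iid M n)" for s
      proof (rule abs_integral_le_bound)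
        show "(\<lambda>z. exp (f (s(n := z)))) \<in> borel_measurable M"
          using sec[OF that] by measurable
      qed (use e_bd space_iid_update[OF that] in auto)
    qed
    have "integrable (iid M n) (\<lambda>s. exp (g s))"
    proof (rule N.integrable_bounded_real)
      show "\<bar>exp (g s)\<bar> \<le> exp B" if "s \<in> space (iid M n)" for s
        using g_bd[OF that] by auto
    qed measurable
    then show "integrable (iid M n) (\<lambda>s. exp (g s) * exp (c\<^sup>2 / 8))"
      by simp
  qed (rule inner)
  also have "\<dots> = (\<integral>s. exp (g s) \<partial>iid M n) * exp (c\<^sup>2 / 8)"
    by simp
  also have "\<dots> \<le> exp ((\<integral>s. g s \<partial>iid M n) + real n * c\<^sup>2 / 8) * exp (c\<^sup>2 / 8)"
    by (intro mult_right_mono Suc.IH g_meas g_bd g_diff) auto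
  also have "(\<integral>s. g s \<partial>iid M n) = (\<integral>s. f s \<partial>iid M (Suc n))"
    unfolding g_def by (rule iid_integral_Suc(1)[OF meas Suc.prems(2), symmetric])
  finally show ?case
    by (simp add: exp_add[symmetric] field_simps)
qed

text \<open>McDiarmid's inequality with difference bounds 1, by Chernoff's method: the exponential
  moment bound for \<open>l * f\<close>, whose differences are at most \<open>l\<close>, is fed into
  Markov's inequality.\<close>

lemma bounded_differences_tail:
  fixes f :: "(nat \<Rightarrow> 'a) \<Rightarrow> real"
  assumes f [measurable]: "f \<in> borel_measurable (iid M n)"
    and bd: "\<And>s. s \<in> space (iid M n) \<Longrightarrow> \<bar>f s\<bar> \<le> B"
    and diff: "\<And>s i z. s \<in> space (iid M n) \<Longrightarrow> i < n \<Longrightarrow> z \<in> space M \<Longrightarrow> \<bar>f (s(i := z)) - f s\<bar> \<le> 1"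
    and n: "n > 0" and t: "t > 0"
  shows "measure (iid M n) {s \<in> space (iid M n). f s \<ge> (\<integral>s. f s \<partial>iid M n) + t}
    \<le> exp (- 2 * t\<^sup>2 / real n)"
proof -
  interpret N: prob_space "iid M n" by (rule prob_space_iid)
  define m where "m = (\<integral>s. f s \<partial>iid M n)"
  \<comment> \<open>This \<open>l\<close> minimises the exponent \<open>n * l^2 / 8 - l * t\<close>,
    with minimum \<open>- 2 * t^2 / n\<close>.\<close>
  define l where "l = 4 * t / real n"
  have l: "l > 0" using n t by (simp add: l_def)
  have int: "integrable (iid M n) f"
    by (rule N.integrable_bounded_real[OF f bd])
  have "(\<integral>s. exp (l * f s) \<partial>iid M n) \<le> exp ((\<integral>s. l * f s \<partial>iid M n) + real n * l\<^sup>2 / 8)"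
  proof (rule bounded_differences_mgf)
    show "\<bar>l * f s\<bar> \<le> l * B" if "s \<in> space (iid M n)" for s
      using bd[OF that] l by (simp add: abs_mult)
    show "\<bar>l * f (s(i := z)) - l * f s\<bar> \<le> l"
      if "s \<in> space (iid M n)" "i < n" "z \<in> space M" for s i z
      using mult_left_mono[OF diff[OF that], of l] l
      by (simp add: abs_mult right_diff_distrib[symmetric])
  qed measurable
  then have mgf: "(\<integral>s. exp (l * f s) \<partial>iid M n) \<le> exp (l * m + real n * l\<^sup>2 / 8)"
    by (simp add: m_def)
  have int_exp: "integrable (iid M n) (\<lambda>s. exp (l * f s))"
  proof (rule N.integrable_bounded_real)
    show "\<bar>exp (l * f s)\<bar> \<le> exp (l * B)" if "s \<in> space (iid M n)" for s
      using bd[OF that] l by auto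
  qed measurable
  have "measure (iid M n) {s \<in> space (iid M n). f s \<ge> m + t}
      = measure (iid M n) {s \<in> space (iid M n). exp (l * (m + t)) \<le> exp (l * f s)}"
    using l by simp
  also have "\<dots> \<le> (\<integral>s. exp (l * f s) \<partial>iid M n) / exp (l * (m + t))"
    by (intro integral_Markov_inequality_measure[where A = "{}"] int_exp) auto
  also have "\<dots> \<le> exp (l * m + real n * l\<^sup>2 / 8) / exp (l * (m + t))"
    using mgf by (intro divide_right_mono) auto
  also have "\<dots> = exp (- 2 * t\<^sup>2 / real n)"
    using n by (simp add: l_def exp_diff[symmetric] field_simps power2_eq_square)
  finally show ?thesis
    by (simp add: m_def)
qed

end

subsection \<open>Expected deviation of linear classes\<close>

text \<open>The two maxima are attained at unrelated points, so a bound over all pairs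
  suffices.\<close>

lemma MAX_add_MAX_le:
  fixes A B :: "'f \<Rightarrow> real"
  assumes "finite F" "F \<noteq> {}" "\<And>f g. f \<in> F \<Longrightarrow> g \<in> F \<Longrightarrow> A f + B g \<le> K"
  shows "(MAX f\<in>F. A f) + (MAX f\<in>F. B f) \<le> K"
proof -
  have "(MAX f\<in>F. A f) \<in> A ` F" "(MAX f\<in>F. B f) \<in> B ` F"
    using assms by (auto intro!: Max_in)
  then show ?thesis
    using assms(3) by auto
qed

text \<open>A difference of losses is bounded by the average over the labels of \<open>card Y\<close> times one
  coordinate difference; this trades the vector-valued contraction for a scalar one.\<close>

lemma MAX_contraction:
  fixes A G :: "'f \<Rightarrow> real" and H :: "'y \<Rightarrow> 'f \<Rightarrow> real"
  assumes F: "finite F" "F \<noteq> {}" and Y: "finite Y" "Y \<noteq> {}"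
    and lip: "\<And>f g. f \<in> F \<Longrightarrow> g \<in> F \<Longrightarrow> \<bar>G f - G g\<bar> \<le> L * (\<Sum>y\<in>Y. \<bar>H y f - H y g\<bar>)"
    and L: "L \<ge> 0"
  shows "(MAX f\<in>F. A f + 2 * G f) + (MAX f\<in>F. A f - 2 * G f)
    \<le> (\<Sum>y\<in>Y. (MAX f\<in>F. A f + 2 * real (card Y) * L * H y f) + (MAX f\<in>F. A f - 2 * real (card Y) * L * H y f)) / card Y"
proof (rule MAX_add_MAX_le[OF F])
  fix f g assume fg: "f \<in> F" "g \<in> F"
  let ?c = "real (card Y)"
  have c: "?c > 0" using Y by (simp add: card_gt_0_iff)
  define K where "K = (\<lambda>y. (MAX f\<in>F. A f + 2 * real (card Y) * L * H y f) + (MAX f\<in>F. A f - 2 * real (card Y) * L * H y f))"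
  have "A f + A g + 2 * ?c * L * \<bar>H y f - H y g\<bar> \<le> K y" for y
  proof -
    have "A f' + 2 * ?c * L * H y f' \<le> (MAX f\<in>F. A f + 2 * real (card Y) * L * H y f)"
      "A f' - 2 * ?c * L * H y f' \<le> (MAX f\<in>F. A f - 2 * real (card Y) * L * H y f)" if "f' \<in> F" for f'
      using F that by (auto intro!: Max_ge)
    \<comment> \<open>\<open>A f + A g\<close> is symmetric, so either of f and g may be inserted
      into the maximum with the plus sign; the sign of \<open>H y f - H y g\<close> decides which
      choice produces the absolute value.\<close>
    from this[OF fg(1)] this[OF fg(2)]
    have "A f + A g + 2 * ?c * L * (H y f - H y g) \<le> K y" "A f + A g + 2 * ?c * L * (H y g - H y f) \<le> K y"
      by (auto simp: K_def algebra_simps)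
    then show ?thesis by (cases "H y f \<ge> H y g") auto
  qed
  then have "(\<Sum>y\<in>Y. A f + A g + 2 * ?c * L * \<bar>H y f - H y g\<bar>) \<le> (\<Sum>y\<in>Y. K y)"
    by (intro sum_mono)
  moreover have "(\<Sum>y\<in>Y. A f + A g + 2 * ?c * L * \<bar>H y f - H y g\<bar>)
      = ?c * (A f + A g + 2 * (L * (\<Sum>y\<in>Y. \<bar>H y f - H y g\<bar>)))"
    by (simp add: sum.distrib sum_distrib_left[symmetric] algebra_simps)
  ultimately have "A f + A g + 2 * (L * (\<Sum>y\<in>Y. \<bar>H y f - H y g\<bar>)) \<le> (\<Sum>y\<in>Y. K y) / ?c"
    using c by (simp add: field_simps)
  with lip[OF fg] show "A f + 2 * G f + (A g - 2 * G g) \<le> (\<Sum>y\<in>Y. K y) / ?c"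
    by linarith
qed

text \<open>Concavity of the square root, used to average over the two signs of a
  perturbation.\<close>

lemma sqrt_add_sqrt_le:
  assumes "0 \<le> x" "0 \<le> y"
  shows "sqrt x + sqrt y \<le> 2 * sqrt ((x + y) / 2)"
proof -
  have "(sqrt x + sqrt y)\<^sup>2 \<le> (2 * sqrt ((x + y) / 2))\<^sup>2"
    using assms sum_squares_bound[of "sqrt x" "sqrt y"]
    by (simp add: power2_sum power_mult_distrib)
  then show ?thesis
    by (rule power2_le_imp_le) (use assms in simp)
qed

lemma sum_mult_add_scaled:
  fixes w v u :: "'j \<Rightarrow> real"
  shows "(\<Sum>j\<in>J. w j * (v j + k * u j)) = (\<Sum>j\<in>J. w j * v j) + k * (\<Sum>j\<in>J. w j * u j)"
  by (simp add: distrib_left sum.distrib sum_distrib_left mult_ac)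

lemma abs_sum_mult_le_L2_set:
  "\<bar>\<Sum>j\<in>J. w j * v j\<bar> \<le> L2_set w J * L2_set v J"
  using L2_set_mult_ineq[of w v J] sum_abs[of "\<lambda>j. w j * v j" J] by (simp add: abs_mult)

context prob_space
begin

text \<open>Symmetrisation without a ghost sample. The argument of the maximum is half of
  \<open>A f + 2 * E (G f)\<close> plus half of \<open>A f - 2 * G f z\<close>. In the first half
  the expectation is pulled out of the maximum, which only increases it. The factors 2 come from
  this splitting.\<close>

lemma MAX_symmetrization:
  fixes G :: "'f \<Rightarrow> 'a \<Rightarrow> real"
  assumes F: "finite F" "F \<noteq> {}" and int: "\<And>f. f \<in> F \<Longrightarrow> integrable M (G f)"
  shows "(\<integral>z. (MAX f\<in>F. A f + ((\<integral>x. G f x \<partial>M) - G f z)) \<partial>M)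
    \<le> (\<integral>z. ((MAX f\<in>F. A f + 2 * G f z) + (MAX f\<in>F. A f - 2 * G f z)) / 2 \<partial>M)"
proof -
  define K where "K = (\<integral>z. (MAX f\<in>F. A f + 2 * G f z) \<partial>M)"
  have int_plus: "integrable M (\<lambda>z. MAX f\<in>F. A f + 2 * G f z)"
    and int_minus: "integrable M (\<lambda>z. MAX f\<in>F. A f - 2 * G f z)"
    and int_centred: "integrable M (\<lambda>z. MAX f\<in>F. A f + ((\<integral>x. G f x \<partial>M) - G f z))"
    using F int by (auto intro!: integrable_MAX)
  have mean: "A f + 2 * (\<integral>x. G f x \<partial>M) \<le> K" if "f \<in> F" for f
  proof -
    have "A f + 2 * (\<integral>x. G f x \<partial>M) = (\<integral>z. A f + 2 * G f z \<partial>M)"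
      using int[OF that] by (simp add: prob_space)
    also have "\<dots> \<le> K"
      unfolding K_def using F that int by (intro integral_mono int_plus) auto
    finally show ?thesis .
  qed
  have "(\<integral>z. (MAX f\<in>F. A f + ((\<integral>x. G f x \<partial>M) - G f z)) \<partial>M)
      \<le> (\<integral>z. K / 2 + (MAX f\<in>F. A f - 2 * G f z) / 2 \<partial>M)"
  proof (rule integral_mono[OF int_centred])
    show "(MAX f\<in>F. A f + ((\<integral>x. G f x \<partial>M) - G f z)) \<le> K / 2 + (MAX f\<in>F. A f - 2 * G f z) / 2" for z
    proof (rule Max.boundedI)
      fix a assume "a \<in> (\<lambda>f. A f + ((\<integral>x. G f x \<partial>M) - G f z)) ` F"
      then obtain f where f: "f \<in> F" and a: "a = A f + ((\<integral>x. G f x \<partial>M) - G f z)"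
        by auto
      have "A f - 2 * G f z \<le> (MAX f\<in>F. A f - 2 * G f z)"
        using F f by (auto intro!: Max_ge)
      with mean[OF f] show "a \<le> K / 2 + (MAX f\<in>F. A f - 2 * G f z) / 2"
        unfolding a by linarith
    qed (use F in auto)
  qed (use int_minus in auto)
  also have "\<dots> = (\<integral>z. ((MAX f\<in>F. A f + 2 * G f z) + (MAX f\<in>F. A f - 2 * G f z)) / 2 \<partial>M)"
    using int_plus int_minus by (simp add: K_def prob_space add_divide_distrib)
  finally show ?thesis .
qed

lemma MAX_symmetrization_contraction:
  fixes G :: "'f \<Rightarrow> 'a \<Rightarrow> real" and H :: "'a \<Rightarrow> 'y \<Rightarrow> 'f \<Rightarrow> real"
  assumes F: "finite F" "F \<noteq> {}" and Y: "finite Y" "Y \<noteq> {}"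
    and int: "\<And>f. f \<in> F \<Longrightarrow> integrable M (G f)"
    and int_T: "integrable M (\<lambda>z. (\<Sum>y\<in>Y. (MAX f\<in>F. A f + 2 * real (card Y) * L * H z y f) + (MAX f\<in>F. A f - 2 * real (card Y) * L * H z y f)) / card Y / 2)"
    and lip: "\<And>f g z. f \<in> F \<Longrightarrow> g \<in> F \<Longrightarrow> z \<in> space M \<Longrightarrow> \<bar>G f z - G g z\<bar> \<le> L * (\<Sum>y\<in>Y. \<bar>H z y f - H z y g\<bar>)"
    and L: "L \<ge> 0"
  shows "(\<integral>z. (MAX f\<in>F. A f + ((\<integral>x. G f x \<partial>M) - G f z)) \<partial>M)
    \<le> (\<integral>z. (\<Sum>y\<in>Y. (MAX f\<in>F. A f + 2 * real (card Y) * L * H z y f) + (MAX f\<in>F. A f - 2 * real (card Y) * L * H z y f)) / card Y / 2 \<partial>M)"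
proof -
  have "integrable M (\<lambda>z. MAX f\<in>F. A f + 2 * G f z)" "integrable M (\<lambda>z. MAX f\<in>F. A f - 2 * G f z)"
    using int by (intro integrable_MAX F; simp)+
  then have "(\<integral>z. ((MAX f\<in>F. A f + 2 * G f z) + (MAX f\<in>F. A f - 2 * G f z)) / 2 \<partial>M)
    \<le> (\<integral>z. (\<Sum>y\<in>Y. (MAX f\<in>F. A f + 2 * real (card Y) * L * H z y f) + (MAX f\<in>F. A f - 2 * real (card Y) * L * H z y f)) / card Y / 2 \<partial>M)"
    by (intro integral_mono int_T divide_right_mono MAX_contraction F Y L lip) auto
  moreover have "(\<integral>z. (MAX f\<in>F. A f + ((\<integral>x. G f x \<partial>M) - G f z)) \<partial>M)
    \<le> (\<integral>z. ((MAX f\<in>F. A f + 2 * G f z) + (MAX f\<in>F. A f - 2 * G f z)) / 2 \<partial>M)"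
    by (rule MAX_symmetrization[OF F int])
  ultimately show ?thesis
    by (rule order_trans[rotated])
qed

text \<open>Symmetrisation, contraction and the averaging over the sign are carried out for one sample at a
  time: each sample point is traded for a perturbation of the direction \<open>v\<close>. The accumulated
  perturbations enter only through their squared lengths, because the two signs average out.\<close>

lemma expected_MAX_deviation_le:
  fixes G :: "'f \<Rightarrow> 'a \<Rightarrow> real" and w :: "'f \<Rightarrow> 'j \<Rightarrow> real" and u :: "'a \<Rightarrow> 'y \<Rightarrow> 'j \<Rightarrow> real"
  assumes F: "finite F" "F \<noteq> {}" and J: "finite J" and Y: "finite Y" "Y \<noteq> {}"
    and G_meas: "\<And>f. f \<in> F \<Longrightarrow> G f \<in> borel_measurable M"
    and G_range: "\<And>f z. f \<in> F \<Longrightarrow> z \<in> space M \<Longrightarrow> 0 \<le> G f z \<and> G f z \<le> 1"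
    and u_meas: "\<And>y j. y \<in> Y \<Longrightarrow> j \<in> J \<Longrightarrow> (\<lambda>z. u z y j) \<in> borel_measurable M"
    and u_norm: "\<And>z y. z \<in> space M \<Longrightarrow> y \<in> Y \<Longrightarrow> L2_set (u z y) J \<le> r"
    and w_norm: "\<And>f. f \<in> F \<Longrightarrow> L2_set (w f) J \<le> B"
    and L: "L \<ge> 0"
    and lip: "\<And>f g z. f \<in> F \<Longrightarrow> g \<in> F \<Longrightarrow> z \<in> space M \<Longrightarrow>
      \<bar>G f z - G g z\<bar> \<le> L * (\<Sum>y\<in>Y. \<bar>(\<Sum>j\<in>J. w f j * u z y j) - (\<Sum>j\<in>J. w g j * u z y j)\<bar>)"
  shows "(\<integral>s. (MAX f\<in>F. (\<Sum>j\<in>J. w f j * v j) + (\<Sum>i<n. (\<integral>z. G f z \<partial>M) - G f (s i))) \<partial>iid M n)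
    \<le> B * sqrt ((\<Sum>j\<in>J. (v j)\<^sup>2) + real n * (2 * real (card Y) * L * r)\<^sup>2)"
proof (induction n arbitrary: v)
  case 0
  interpret N: prob_space "iid M 0" by (rule prob_space_iid)
  have "(MAX f\<in>F. (\<Sum>j\<in>J. w f j * v j)) \<le> B * sqrt (\<Sum>j\<in>J. (v j)\<^sup>2)"
  proof (rule Max.boundedI)
    fix a assume "a \<in> (\<lambda>f. \<Sum>j\<in>J. w f j * v j) ` F"
    then obtain f where f: "f \<in> F" "a = (\<Sum>j\<in>J. w f j * v j)" by auto
    have "a \<le> L2_set (w f) J * L2_set v J"
      using abs_sum_mult_le_L2_set[of "w f" v J] f by linarith
    also have "\<dots> \<le> B * L2_set v J"
      using w_norm[OF f(1)] by (intro mult_right_mono) auto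
    finally show "a \<le> B * sqrt (\<Sum>j\<in>J. (v j)\<^sup>2)"
      by (simp add: L2_set_def)
  qed (use F in auto)
  then show ?case
    using N.prob_space by simp
next
  case (Suc n)
  interpret N: prob_space "iid M n" by (rule prob_space_iid)
  define c where "c = real (card Y)"
  have c: "c > 0" using Y by (simp add: c_def card_gt_0_iff)
  define m where "m = (\<lambda>f. \<integral>z. G f z \<partial>M)"
  define D where "D = (\<lambda>f s. \<Sum>i<n. m f - G f (s i))"
  define \<Psi> where "\<Psi> = (\<lambda>v s. MAX f\<in>F. (\<Sum>j\<in>J. w f j * v j) + D f s)"
  \<comment> \<open>Adding a multiple of the linear score of \<open>u z y\<close> to the objective
    amounts to shifting the direction \<open>v\<close>, so the shifted maximum has the form required
    by the induction hypothesis. In \<open>2 * c * L\<close> the 2 stems from symmetrisation and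
    \<open>c * L\<close> from contraction.\<close>
  define up where "up = (\<lambda>z y j. v j + 2 * c * L * u z y j)"
  define dn where "dn = (\<lambda>z y j. v j + - (2 * c * L) * u z y j)"
  define T where "T = (\<lambda>s. (\<Sum>y\<in>Y. \<Psi> (up (s n) y) s + \<Psi> (dn (s n) y) s) / c / 2)"
  define f' where "f' = (\<lambda>s. MAX f\<in>F. (\<Sum>j\<in>J. w f j * v j) + (\<Sum>i<Suc n. m f - G f (s i)))"
  define R where "R = B * sqrt ((\<Sum>j\<in>J. (v j)\<^sup>2) + real (Suc n) * (2 * c * L * r)\<^sup>2)"
  have B: "B \<ge> 0"
    using F w_norm L2_set_nonneg order_trans by blast
  have r: "r \<ge> 0"
    using not_empty Y u_norm L2_set_nonneg order_trans by blast
  have G_int: "integrable M (G f)" if "f \<in> F" for f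
    using G_range[OF that] by (intro integrable_bounded_real[of _ 1] G_meas that) auto
  have m_range: "0 \<le> m f" "m f \<le> 1" if "f \<in> F" for f
    unfolding m_def using G_int[OF that] G_range[OF that]
    by (auto intro!: integral_ge_const integral_le_const)
  have D_upd: "D f (s(n := z)) = D f s" for f s z
    by (simp add: D_def)
  have \<Psi>_upd: "\<Psi> v' (s(n := z)) = \<Psi> v' s" for v' s z
    by (simp add: \<Psi>_def D_upd)
  have D_bd: "\<bar>D f s\<bar> \<le> real n" if "f \<in> F" "\<And>i. i < n \<Longrightarrow> s i \<in> space M" for f s
  proof -
    have "\<bar>D f s\<bar> \<le> (\<Sum>i<n. \<bar>m f - G f (s i)\<bar>)"
      unfolding D_def by (rule sum_abs)
    also have "\<dots> \<le> (\<Sum>i<n. 1)"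
    proof (rule sum_mono)
      fix i assume "i \<in> {..<n}"
      then have "0 \<le> G f (s i)" "G f (s i) \<le> 1"
        using G_range[OF that(1), of "s i"] that(2) by auto
      then show "\<bar>m f - G f (s i)\<bar> \<le> 1"
        using m_range[OF that(1)] by auto
    qed
    finally show ?thesis by simp
  qed
  have \<Psi>_bd: "\<bar>\<Psi> v' s\<bar> \<le> B * L2_set v' J + real n" if s: "\<And>i. i < n \<Longrightarrow> s i \<in> space M" for v' s
  proof -
    have "\<Psi> v' s \<in> (\<lambda>f. (\<Sum>j\<in>J. w f j * v' j) + D f s) ` F"
      unfolding \<Psi>_def using F by (intro Max_in) auto
    then obtain f where f: "f \<in> F" "\<Psi> v' s = (\<Sum>j\<in>J. w f j * v' j) + D f s" by auto
    have "\<bar>\<Sum>j\<in>J. w f j * v' j\<bar> \<le> L2_set (w f) J * L2_set v' J"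
      by (rule abs_sum_mult_le_L2_set)
    also have "\<dots> \<le> B * L2_set v' J"
      using w_norm[OF f(1)] by (intro mult_right_mono) auto
    finally have "\<bar>\<Sum>j\<in>J. w f j * v' j\<bar> \<le> B * L2_set v' J" .
    moreover have "\<bar>D f s\<bar> \<le> real n"
      by (rule D_bd) (use f s in auto)
    ultimately show ?thesis
      unfolding f(2) by linarith
  qed
  have pert: "L2_set (up z y) J \<le> L2_set v J + 2 * c * L * r" "L2_set (dn z y) J \<le> L2_set v J + 2 * c * L * r"
    if "z \<in> space M" "y \<in> Y" for z y
  proof -
    have *: "L2_set (\<lambda>j. a * u z y j) J \<le> \<bar>a\<bar> * r" for a
    proof -
      have "L2_set (\<lambda>j. a * u z y j) J = \<bar>a\<bar> * L2_set (u z y) J"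
        by (simp add: L2_set_def power_mult_distrib sum_distrib_left[symmetric] real_sqrt_mult)
      then show ?thesis
        using u_norm[OF that] by (simp add: mult_left_mono)
    qed
    show "L2_set (up z y) J \<le> L2_set v J + 2 * c * L * r"
      using L2_set_triangle_ineq[of v "\<lambda>j. 2 * c * L * u z y j" J] *[of "2 * c * L"] c L
      by (simp add: up_def)
    show "L2_set (dn z y) J \<le> L2_set v J + 2 * c * L * r"
      using L2_set_triangle_ineq[of v "\<lambda>j. - (2 * c * L) * u z y j" J] *[of "- (2 * c * L)"] c L
      by (simp add: dn_def)
  qed
  \<comment> \<open>A crude bound, uniform in the sample, that serves integrability only.\<close>
  define K where "K = B * (L2_set v J + 2 * c * L * r) + real n"
  have \<Psi>_pert_bd: "\<bar>\<Psi> (up z y) s\<bar> \<le> K" "\<bar>\<Psi> (dn z y) s\<bar> \<le> K"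
    if "z \<in> space M" "y \<in> Y" "\<And>i. i < n \<Longrightarrow> s i \<in> space M" for z y s
  proof -
    have "\<bar>\<Psi> (up z y) s\<bar> \<le> B * L2_set (up z y) J + real n" "\<bar>\<Psi> (dn z y) s\<bar> \<le> B * L2_set (dn z y) J + real n"
      by (rule \<Psi>_bd; use that(3) in simp)+
    then show "\<bar>\<Psi> (up z y) s\<bar> \<le> K" "\<bar>\<Psi> (dn z y) s\<bar> \<le> K"
      using mult_left_mono[OF pert(1)[OF that(1,2)] B] mult_left_mono[OF pert(2)[OF that(1,2)] B]
      unfolding K_def by linarith+
  qed
  have space_n: "s i \<in> space M" if "s \<in> space (iid M k)" "i < k" for s i k
    using that by (auto simp: space_PiM)
  have D_meas: "D f \<in> borel_measurable (iid M k)" if "f \<in> F" "n \<le> k" for f k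
    unfolding D_def
  proof (intro borel_measurable_sum borel_measurable_diff borel_measurable_const)
    fix i assume "i \<in> {..<n}"
    then show "(\<lambda>s. G f (s i)) \<in> borel_measurable (iid M k)"
      using that by (intro iid_component_measurable G_meas) auto
  qed
  have u_comp: "(\<lambda>s. u (s n) y j) \<in> borel_measurable (iid M (Suc n))" if "y \<in> Y" "j \<in> J" for y j
    using that by (intro iid_component_measurable[of "\<lambda>z. u z y j"] u_meas) auto
  have \<Psi>_meas: "\<Psi> v' \<in> borel_measurable (iid M n)" for v'
    unfolding \<Psi>_def by (intro borel_measurable_Max F borel_measurable_add borel_measurable_const D_meas) auto
  have \<Psi>_up_meas: "(\<lambda>s. \<Psi> (up (s n) y) s) \<in> borel_measurable (iid M (Suc n))"
    and \<Psi>_dn_meas: "(\<lambda>s. \<Psi> (dn (s n) y) s) \<in> borel_measurable (iid M (Suc n))" if "y \<in> Y" for y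
    unfolding \<Psi>_def up_def dn_def
    by (intro borel_measurable_Max F borel_measurable_add borel_measurable_diff borel_measurable_times
        borel_measurable_sum borel_measurable_const D_meas u_comp that; simp)+
  have T_meas: "T \<in> borel_measurable (iid M (Suc n))"
    unfolding T_def
    by (intro borel_measurable_divide borel_measurable_sum borel_measurable_add borel_measurable_const
        \<Psi>_up_meas \<Psi>_dn_meas)
  have T_bd: "\<bar>T s\<bar> \<le> K" if s: "s \<in> space (iid M (Suc n))" for s
  proof -
    have "\<bar>\<Sum>y\<in>Y. \<Psi> (up (s n) y) s + \<Psi> (dn (s n) y) s\<bar> \<le> (\<Sum>y\<in>Y. 2 * K)"
    proof (rule order_trans[OF sum_abs sum_mono])
      fix y assume y: "y \<in> Y"
      show "\<bar>\<Psi> (up (s n) y) s + \<Psi> (dn (s n) y) s\<bar> \<le> 2 * K"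
      proof -
        have "\<bar>\<Psi> (up (s n) y) s\<bar> \<le> K" "\<bar>\<Psi> (dn (s n) y) s\<bar> \<le> K"
          by (rule \<Psi>_pert_bd; use space_n[OF s] y in simp)+
        then show ?thesis by linarith
      qed
    qed
    then show ?thesis
      using c by (simp add: T_def c_def field_simps)
  qed
  have f'_D: "f' (s(n := z)) = (MAX f\<in>F. ((\<Sum>j\<in>J. w f j * v j) + D f s) + (m f - G f z))" for s z
    by (simp add: f'_def D_def add.assoc)
  have f'_meas: "f' \<in> borel_measurable (iid M (Suc n))"
    unfolding f'_def
  proof (intro borel_measurable_Max F borel_measurable_add borel_measurable_diff
        borel_measurable_sum borel_measurable_const)
    fix f i assume "f \<in> F" "i \<in> {..<Suc n}"
    then show "(\<lambda>s. G f (s i)) \<in> borel_measurable (iid M (Suc n))"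
      by (intro iid_component_measurable G_meas) auto
  qed
  have f'_bd: "\<bar>f' s\<bar> \<le> B * L2_set v J + real n + 1" if s: "s \<in> space (iid M (Suc n))" for s
  proof -
    have "f' s \<in> (\<lambda>f. (\<Sum>j\<in>J. w f j * v j) + (\<Sum>i<Suc n. m f - G f (s i))) ` F"
      unfolding f'_def using F by (intro Max_in) auto
    then obtain f where f: "f \<in> F" "f' s = (\<Sum>j\<in>J. w f j * v j) + D f s + (m f - G f (s n))"
      by (auto simp: D_def)
    have "\<bar>\<Sum>j\<in>J. w f j * v j\<bar> \<le> L2_set (w f) J * L2_set v J"
      by (rule abs_sum_mult_le_L2_set)
    also have "\<dots> \<le> B * L2_set v J"
      using w_norm[OF f(1)] by (intro mult_right_mono) auto
    moreover have "\<bar>D f s\<bar> \<le> real n"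
      using D_bd[OF f(1)] space_n[OF s] by auto
    moreover have "\<bar>m f - G f (s n)\<bar> \<le> 1"
      using m_range[OF f(1)] G_range[OF f(1) space_n[OF s, of n]] by (simp add: abs_le_iff)
    ultimately show ?thesis
      unfolding f(2) by linarith
  qed
  have T_upd: "T (s(n := z)) = (\<Sum>y\<in>Y. (MAX f\<in>F. ((\<Sum>j\<in>J. w f j * v j) + D f s) + 2 * real (card Y) * L * (\<Sum>j\<in>J. w f j * u z y j))
      + (MAX f\<in>F. ((\<Sum>j\<in>J. w f j * v j) + D f s) - 2 * real (card Y) * L * (\<Sum>j\<in>J. w f j * u z y j))) / card Y / 2" for s z
  proof -
    have eqs: "(\<Sum>j\<in>J. w f j * up z y j) + D f s = ((\<Sum>j\<in>J. w f j * v j) + D f s) + 2 * c * L * (\<Sum>j\<in>J. w f j * u z y j)"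
      "(\<Sum>j\<in>J. w f j * dn z y j) + D f s = ((\<Sum>j\<in>J. w f j * v j) + D f s) - 2 * c * L * (\<Sum>j\<in>J. w f j * u z y j)" for y f
      unfolding up_def dn_def sum_mult_add_scaled by simp_all
    show ?thesis
      unfolding T_def \<Psi>_upd fun_upd_same unfolding \<Psi>_def eqs c_def by (rule refl)
  qed
  have step: "(\<integral>z. f' (s(n := z)) \<partial>M) \<le> (\<integral>z. T (s(n := z)) \<partial>M)" if s: "s \<in> space (iid M n)" for s
  proof -
    have "integrable M (\<lambda>z. T (s(n := z)))"
      by (rule integrable_bounded_real[OF iid_section_measurable[OF T_meas s]])
         (rule T_bd[OF space_iid_update[OF s]])
    then show ?thesis
      unfolding f'_D T_upd unfolding m_def
      by (intro MAX_symmetrization_contraction F Y G_int lip L)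
  qed
  have \<Psi>_int: "integrable (iid M n) (\<Psi> v')" for v'
    by (rule N.integrable_bounded_real[OF \<Psi>_meas \<Psi>_bd]) (auto intro: space_n)
  have T_le: "(\<integral>s. T (s(n := z)) \<partial>iid M n) \<le> R" if z: "z \<in> space M" for z
  proof -
    have pair: "(\<integral>s. \<Psi> (up z y) s \<partial>iid M n) + (\<integral>s. \<Psi> (dn z y) s \<partial>iid M n) \<le> 2 * R" if y: "y \<in> Y" for y
    proof -
      define q where "q = (2 * c * L * r)\<^sup>2"
      have IH: "(\<integral>s. \<Psi> v' s \<partial>iid M n) \<le> B * sqrt ((\<Sum>j\<in>J. (v' j)\<^sup>2) + real n * q)" for v'
        using Suc.IH[of v'] by (simp add: \<Psi>_def D_def m_def c_def q_def)
      have "(2 * c * L)\<^sup>2 * (\<Sum>j\<in>J. (u z y j)\<^sup>2) \<le> (2 * c * L)\<^sup>2 * r\<^sup>2"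
      proof (rule mult_left_mono)
        show "(\<Sum>j\<in>J. (u z y j)\<^sup>2) \<le> r\<^sup>2"
          using u_norm[OF z y] r by (simp add: L2_set_def sqrt_le_D)
      qed simp
      then have uq: "(2 * c * L)\<^sup>2 * (\<Sum>j\<in>J. (u z y j)\<^sup>2) \<le> q"
        by (simp add: q_def power_mult_distrib)
      \<comment> \<open>The parallelogram identity: the mixed terms of the two signs cancel, so only
        the squared length of the perturbation is added.\<close>
      have par: "(\<Sum>j\<in>J. (up z y j)\<^sup>2) + (\<Sum>j\<in>J. (dn z y j)\<^sup>2)
          = 2 * (\<Sum>j\<in>J. (v j)\<^sup>2) + 2 * ((2 * c * L)\<^sup>2 * (\<Sum>j\<in>J. (u z y j)\<^sup>2))"
        by (simp add: up_def dn_def power2_sum power2_diff power_mult_distrib sum.distrib[symmetric] sum_distrib_left mult_ac)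
      have q: "q \<ge> 0" by (simp add: q_def)
      have "(\<integral>s. \<Psi> (up z y) s \<partial>iid M n) + (\<integral>s. \<Psi> (dn z y) s \<partial>iid M n)
          \<le> B * (sqrt ((\<Sum>j\<in>J. (up z y j)\<^sup>2) + real n * q) + sqrt ((\<Sum>j\<in>J. (dn z y j)\<^sup>2) + real n * q))"
        using IH[of "up z y"] IH[of "dn z y"] by (simp add: distrib_left)
      also have "\<dots> \<le> B * (2 * sqrt (((\<Sum>j\<in>J. (up z y j)\<^sup>2) + real n * q + ((\<Sum>j\<in>J. (dn z y j)\<^sup>2) + real n * q)) / 2))"
        using q by (intro mult_left_mono sqrt_add_sqrt_le B add_nonneg_nonneg sum_nonneg mult_nonneg_nonneg) auto
      also have "\<dots> \<le> B * (2 * sqrt ((\<Sum>j\<in>J. (v j)\<^sup>2) + real (Suc n) * q))"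
        using uq par by (intro mult_left_mono B real_sqrt_le_mono) (auto simp: algebra_simps)
      finally show ?thesis
        by (simp add: R_def q_def)
    qed
    have "(\<integral>s. T (s(n := z)) \<partial>iid M n)
        = (\<Sum>y\<in>Y. (\<integral>s. \<Psi> (up z y) s \<partial>iid M n) + (\<integral>s. \<Psi> (dn z y) s \<partial>iid M n)) / c / 2"
      using \<Psi>_int by (simp add: T_def \<Psi>_upd)
    also have "\<dots> \<le> (\<Sum>y\<in>Y. 2 * R) / c / 2"
      using c pair by (intro divide_right_mono sum_mono) auto
    also have "\<dots> = R"
      using c by (simp add: c_def)
    finally show ?thesis .
  qed
  have "(\<integral>s. f' s \<partial>iid M (Suc n)) = (\<integral>s. (\<integral>z. f' (s(n := z)) \<partial>M) \<partial>iid M n)"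
    by (rule iid_integral_Suc(1)[OF f'_meas f'_bd])
  also have "\<dots> \<le> (\<integral>s. (\<integral>z. T (s(n := z)) \<partial>M) \<partial>iid M n)"
  proof (rule integral_mono)
    show "integrable (iid M n) (\<lambda>s. \<integral>z. f' (s(n := z)) \<partial>M)"
      by (rule N.integrable_bounded_real[OF iid_marginal_measurable[OF f'_meas]])
         (rule abs_integral_le_bound[OF iid_section_measurable[OF f'_meas] f'_bd[OF space_iid_update]])
    show "integrable (iid M n) (\<lambda>s. \<integral>z. T (s(n := z)) \<partial>M)"
      by (rule N.integrable_bounded_real[OF iid_marginal_measurable[OF T_meas]])
         (rule abs_integral_le_bound[OF iid_section_measurable[OF T_meas] T_bd[OF space_iid_update]])
  qed (rule step)
  \<comment> \<open>The order of integration is swapped: once the last point z is fixed,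
    \<open>up z y\<close> and \<open>dn z y\<close> are fixed directions, and the induction
    hypothesis applies to each of them.\<close>
  also have "\<dots> = (\<integral>s. T s \<partial>iid M (Suc n))"
    by (rule iid_integral_Suc(1)[OF T_meas T_bd, symmetric])
  also have "\<dots> = (\<integral>z. (\<integral>s. T (s(n := z)) \<partial>iid M n) \<partial>M)"
    by (rule iid_integral_Suc(2)[OF T_meas T_bd])
  also have "\<dots> \<le> R"
  proof (cases "integrable M (\<lambda>z. \<integral>s. T (s(n := z)) \<partial>iid M n)")
    case True
    then show ?thesis
      using T_le by (intro integral_le_const) auto
  next
    case False
    \<comment> \<open>A non-integrable function has integral 0 by convention, which the nonnegative
      \<open>R\<close> bounds as well.\<close>
    have "R \<ge> 0"
      unfolding R_def using B by (intro mult_nonneg_nonneg real_sqrt_ge_zero add_nonneg_nonneg sum_nonneg) auto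
    with False show ?thesis
      by (simp add: not_integrable_integral_eq)
  qed
  finally show ?case
    by (simp add: f'_def m_def R_def c_def)
qed

end

subsection \<open>Margin loss\<close>

text \<open>Labels outside \<open>{1..c}\<close> get loss \<open>0\<close>, so that the Lipschitz bound in the scores of the labels
  \<open>1, \<dots>, c\<close> holds on the whole space.\<close>

definition margin_loss :: "nat \<Rightarrow> real \<Rightarrow> ('x \<Rightarrow> nat \<Rightarrow> real) \<Rightarrow> 'x \<times> nat \<Rightarrow> real" where
  "margin_loss c \<gamma> h p = (if snd p \<in> {1..c}
     then Phi ((h (fst p) (snd p) - Max ((\<lambda>y'. h (fst p) y') ` ({1..c} - {snd p}))) / \<gamma>) else 0)"

lemma Phi_range: "0 \<le> Phi u" "Phi u \<le> 1"
  by (auto simp: Phi_def)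

lemma Phi_lipschitz: "\<bar>Phi u - Phi v\<bar> \<le> \<bar>u - v\<bar>"
  by (auto simp: Phi_def min_def max_def abs_if)

lemma margin_loss_range: "0 \<le> margin_loss c \<gamma> h p" "margin_loss c \<gamma> h p \<le> 1"
  by (auto simp: margin_loss_def Phi_range)

lemma Max_diff_le:
  fixes a b :: "'y \<Rightarrow> real"
  assumes "finite A" "A \<noteq> {}"
  shows "Max (a ` A) - Max (b ` A) \<le> (\<Sum>y\<in>A. \<bar>a y - b y\<bar>)"
proof -
  have "Max (a ` A) \<in> a ` A" using assms by (intro Max_in) auto
  then obtain y where y: "y \<in> A" "Max (a ` A) = a y" by auto
  have "b y \<le> Max (b ` A)" using assms y by (intro Max_ge) auto
  moreover have "\<bar>a y - b y\<bar> \<le> (\<Sum>y\<in>A. \<bar>a y - b y\<bar>)"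
    using assms y by (intro member_le_sum) auto
  ultimately show ?thesis using y(2) by linarith
qed

text \<open>The own score accounts for the term of the own label, and the maximum over the
  competitors moves by at most the sum of their terms. Each label is counted once, hence the
  constant is exactly \<open>1 / \<gamma>\<close>.\<close>

lemma margin_loss_lipschitz:
  assumes c: "c \<ge> 2" and \<gamma>: "\<gamma> > 0"
  shows "\<bar>margin_loss c \<gamma> g p - margin_loss c \<gamma> h p\<bar> \<le> 1 / \<gamma> * (\<Sum>y\<in>{1..c}. \<bar>g (fst p) y - h (fst p) y\<bar>)"
proof (cases "snd p \<in> {1..c}")
  case True
  define A where "A = {1..c} - {snd p}"
  \<comment> \<open>At least two labels are needed for a competitor to exist; otherwise
    \<open>Max\<close> would range over the empty set.\<close>
  have "(if snd p = 1 then 2 else 1) \<in> A" using c by (simp add: A_def)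
  then have A: "finite A" "A \<noteq> {}" by (auto simp: A_def)
  let ?g = "g (fst p)" and ?h = "h (fst p)"
  have "\<bar>Max (?g ` A) - Max (?h ` A)\<bar> \<le> (\<Sum>y\<in>A. \<bar>?g y - ?h y\<bar>)"
    using Max_diff_le[OF A, of ?g ?h] Max_diff_le[OF A, of ?h ?g] by (simp add: abs_minus_commute abs_le_iff)
  moreover have "(\<Sum>y\<in>{1..c}. \<bar>?g y - ?h y\<bar>) = \<bar>?g (snd p) - ?h (snd p)\<bar> + (\<Sum>y\<in>A. \<bar>?g y - ?h y\<bar>)"
    using True by (simp add: A_def sum.remove)
  ultimately have *: "\<bar>(?g (snd p) - Max (?g ` A)) - (?h (snd p) - Max (?h ` A))\<bar> \<le> (\<Sum>y\<in>{1..c}. \<bar>?g y - ?h y\<bar>)"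
    by linarith
  have "\<bar>margin_loss c \<gamma> g p - margin_loss c \<gamma> h p\<bar>
      \<le> \<bar>(?g (snd p) - Max (?g ` A)) / \<gamma> - (?h (snd p) - Max (?h ` A)) / \<gamma>\<bar>"
    using True by (simp add: margin_loss_def Phi_lipschitz A_def)
  also have "\<dots> = \<bar>(?g (snd p) - Max (?g ` A)) - (?h (snd p) - Max (?h ` A))\<bar> / \<gamma>"
    using \<gamma> by (simp add: diff_divide_distrib[symmetric])
  also have "\<dots> \<le> (\<Sum>y\<in>{1..c}. \<bar>?g y - ?h y\<bar>) / \<gamma>"
    using * \<gamma> by (intro divide_right_mono) auto
  finally show ?thesis by simp
next
  case False
  then show ?thesis
    using \<gamma> unfolding margin_loss_def if_not_P[OF False] by (simp add: sum_nonneg)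
qed

text \<open>The set of competitors depends on the label, so measurability is shown for each fixed
  label and then glued along the countably many values of the label.\<close>

lemma margin_loss_measurable:
  fixes h :: "'x::second_countable_topology \<Rightarrow> nat \<Rightarrow> real"
  assumes P: "sets P = sets (borel :: ('x \<times> nat) measure)"
    and h: "\<And>y. y \<in> {1..c} \<Longrightarrow> (\<lambda>x. h x y) \<in> borel_measurable borel"
  shows "margin_loss c \<gamma> h \<in> borel_measurable P"
proof -
  have fst: "fst \<in> borel \<rightarrow>\<^sub>M (borel :: 'x measure)" and snd: "snd \<in> borel \<rightarrow>\<^sub>M (count_space UNIV :: nat measure)"
    unfolding measurable_cong_sets[OF refl sets_borel_eq_count_space[symmetric]]
    by (intro borel_measurable_continuous_onI continuous_intros)+
  have "(\<lambda>p. if y \<in> {1..c} then Phi ((h (fst p) y - Max ((\<lambda>y'. h (fst p) y') ` ({1..c} - {y}))) / \<gamma>) else 0)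
      \<in> borel_measurable borel" for y
  proof (cases "y \<in> {1..c}")
    case True
    have comp: "(\<lambda>p. h (fst p) y') \<in> borel_measurable borel" if "y' \<in> {1..c}" for y'
      using measurable_compose[OF fst h[OF that]] .
    have "(\<lambda>p. h (fst p) y - Max ((\<lambda>y'. h (fst p) y') ` ({1..c} - {y}))) \<in> borel_measurable borel"
      using True by (intro borel_measurable_diff borel_measurable_Max comp) auto
    then show ?thesis
      unfolding Phi_def if_P[OF True] by measurable
  next
    case False
    show ?thesis
      unfolding if_not_P[OF False] by simp
  qed
  then have "(\<lambda>p. (\<lambda>y p. if y \<in> {1..c} then Phi ((h (fst p) y - Max ((\<lambda>y'. h (fst p) y') ` ({1..c} - {y}))) / \<gamma>) else 0) (snd p) p)
      \<in> borel_measurable borel"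
    by (rule measurable_compose_countable[OF _ snd])
  then show ?thesis
    unfolding margin_loss_def[abs_def] measurable_cong_sets[OF P refl] by simp
qed

lemma margin_loss_tendsto:
  assumes c: "c \<ge> 2" and \<gamma>: "\<gamma> > 0"
    and lim: "\<And>y. y \<in> {1..c} \<Longrightarrow> (\<lambda>k. h k (fst p) y) \<longlonglongrightarrow> h' (fst p) y"
  shows "(\<lambda>k. margin_loss c \<gamma> (h k) p) \<longlonglongrightarrow> margin_loss c \<gamma> h' p"
proof -
  have "(\<lambda>k. 1 / \<gamma> * (\<Sum>y\<in>{1..c}. \<bar>h k (fst p) y - h' (fst p) y\<bar>))
      \<longlonglongrightarrow> 1 / \<gamma> * (\<Sum>y\<in>{1..c}. \<bar>h' (fst p) y - h' (fst p) y\<bar>)"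
    by (intro tendsto_intros lim)
  then have "(\<lambda>k. 1 / \<gamma> * (\<Sum>y\<in>{1..c}. \<bar>h k (fst p) y - h' (fst p) y\<bar>)) \<longlonglongrightarrow> 0"
    by simp
  then have "(\<lambda>k. margin_loss c \<gamma> (h k) p - margin_loss c \<gamma> h' p) \<longlonglongrightarrow> 0"
    by (rule Lim_null_comparison[rotated])
       (use margin_loss_lipschitz[OF c \<gamma>, of "h _" p h'] in \<open>auto intro!: always_eventually\<close>)
  then show ?thesis
    by (rule LIM_zero_cancel)
qed

text \<open>Losses lie in [0, 1], so dominated convergence handles the risk, and the empirical part
  is a finite sum. It serves twice: from a dense set of weights to the whole ball, and from
  truncated scores to their series.\<close>

lemma risk_bound_limit:
  fixes h :: "nat \<Rightarrow> 'x::second_countable_topology \<Rightarrow> nat \<Rightarrow> real"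
  assumes P: "prob_space P" "sets P = sets (borel :: ('x \<times> nat) measure)"
    and c: "c \<ge> 2" and \<gamma>: "\<gamma> > 0"
    and meas: "\<And>k y. y \<in> {1..c} \<Longrightarrow> (\<lambda>x. h k x y) \<in> borel_measurable borel"
    and lim: "\<And>x y. y \<in> {1..c} \<Longrightarrow> (\<lambda>k. h k x y) \<longlonglongrightarrow> h' x y"
    and le: "\<And>k. (\<integral>p. margin_loss c \<gamma> (h k) p \<partial>P) \<le> 1 / real n * (\<Sum>i<n. margin_loss c \<gamma> (h k) (s i)) + b"
  shows "(\<integral>p. margin_loss c \<gamma> h' p \<partial>P) \<le> 1 / real n * (\<Sum>i<n. margin_loss c \<gamma> h' (s i)) + b"
proof (rule LIMSEQ_le)
  interpret prob_space P by fact
  have meas': "(\<lambda>x. h' x y) \<in> borel_measurable borel" if "y \<in> {1..c}" for y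
    using meas[OF that] lim[OF that] by (rule borel_measurable_LIMSEQ_real[rotated])
  show "(\<lambda>k. \<integral>p. margin_loss c \<gamma> (h k) p \<partial>P) \<longlonglongrightarrow> (\<integral>p. margin_loss c \<gamma> h' p \<partial>P)"
  proof (rule integral_dominated_convergence)
    show "margin_loss c \<gamma> h' \<in> borel_measurable P"
      by (rule margin_loss_measurable[OF P(2) meas'])
    show "margin_loss c \<gamma> (h k) \<in> borel_measurable P" for k
      by (rule margin_loss_measurable[OF P(2) meas])
    show "AE p in P. (\<lambda>k. margin_loss c \<gamma> (h k) p) \<longlonglongrightarrow> margin_loss c \<gamma> h' p"
      by (intro AE_I2 margin_loss_tendsto c \<gamma> lim)
    show "AE p in P. norm (margin_loss c \<gamma> (h k) p) \<le> 1" for k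
      by (simp add: margin_loss_range)
  qed simp
  show "(\<lambda>k. 1 / real n * (\<Sum>i<n. margin_loss c \<gamma> (h k) (s i)) + b)
      \<longlonglongrightarrow> 1 / real n * (\<Sum>i<n. margin_loss c \<gamma> h' (s i)) + b"
    by (intro tendsto_intros margin_loss_tendsto c \<gamma> lim)
qed (use le in auto)

text \<open>Continuity from above along the events for finite initial segments of an enumeration; it
  works because \<open>q\<close> does not depend on the size of the finite class.\<close>

lemma (in prob_space) prob_countable_family:
  assumes D: "countable D"
    and meas: "\<And>f. f \<in> D \<Longrightarrow> {s \<in> space M. Q f s} \<in> events"
    and fin: "\<And>F. finite F \<Longrightarrow> F \<subseteq> D \<Longrightarrow> q \<le> prob {s \<in> space M. \<forall>f\<in>F. Q f s}"
  shows "{s \<in> space M. \<forall>f\<in>D. Q f s} \<in> events" "q \<le> prob {s \<in> space M. \<forall>f\<in>D. Q f s}"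
proof -
  show "{s \<in> space M. \<forall>f\<in>D. Q f s} \<in> events"
    using meas D by (rule sets.sets_Collect_countable_All')
  show "q \<le> prob {s \<in> space M. \<forall>f\<in>D. Q f s}"
  proof (cases "D = {}")
    case True
    then show ?thesis using fin[of "{}"] by simp
  next
    case False
    define d where "d = from_nat_into D"
    have d: "range d = D" using D False by (simp add: d_def range_from_nat_into)
    define E where "E = (\<lambda>k. {s \<in> space M. \<forall>f\<in>d ` {..k}. Q f s})"
    have E_meas: "E k \<in> events" for k
      unfolding E_def using meas d by (intro sets.sets_Collect_finite_All) auto
    have "(\<lambda>k. prob (E k)) \<longlonglongrightarrow> prob (\<Inter>k. E k)"
      by (rule finite_Lim_measure_decseq) (use E_meas in \<open>auto simp: decseq_def E_def\<close>)
    moreover have "q \<le> prob (E k)" for k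
      unfolding E_def by (rule fin) (use d in auto)
    ultimately have "q \<le> prob (\<Inter>k. E k)"
      by (intro LIMSEQ_le_const) auto
    also have "(\<Inter>k. E k) = {s \<in> space M. \<forall>f\<in>D. Q f s}"
      unfolding E_def d[symmetric] by auto
    finally show ?thesis .
  qed
qed

section \<open>High-probability deviation bound for finite classes\<close>

context prob_space
begin

lemma finite_class_deviation:
  fixes G :: "'f \<Rightarrow> 'a \<Rightarrow> real" and w :: "'f \<Rightarrow> 'j \<Rightarrow> real" and u :: "'a \<Rightarrow> 'y \<Rightarrow> 'j \<Rightarrow> real"
  assumes F: "finite F" and J: "finite J" and Y: "finite Y" "Y \<noteq> {}"
    and G_meas: "\<And>f. f \<in> F \<Longrightarrow> G f \<in> borel_measurable M"
    and G_range: "\<And>f z. f \<in> F \<Longrightarrow> z \<in> space M \<Longrightarrow> 0 \<le> G f z \<and> G f z \<le> 1"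
    and u_meas: "\<And>y j. y \<in> Y \<Longrightarrow> j \<in> J \<Longrightarrow> (\<lambda>z. u z y j) \<in> borel_measurable M"
    and u_norm: "\<And>z y. z \<in> space M \<Longrightarrow> y \<in> Y \<Longrightarrow> L2_set (u z y) J \<le> r"
    and w_norm: "\<And>f. f \<in> F \<Longrightarrow> L2_set (w f) J \<le> B"
    and L: "L \<ge> 0" and r: "r \<ge> 0"
    and lip: "\<And>f g z. f \<in> F \<Longrightarrow> g \<in> F \<Longrightarrow> z \<in> space M \<Longrightarrow>
      \<bar>G f z - G g z\<bar> \<le> L * (\<Sum>y\<in>Y. \<bar>(\<Sum>j\<in>J. w f j * u z y j) - (\<Sum>j\<in>J. w g j * u z y j)\<bar>)"
    and n: "n > 0" and \<delta>: "0 < \<delta>" "\<delta> < 1"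
  shows "1 - \<delta> \<le> measure (iid M n) {s \<in> space (iid M n). \<forall>f\<in>F. (\<integral>z. G f z \<partial>M)
    \<le> 1 / real n * (\<Sum>i<n. G f (s i)) + (2 * real (card Y) * L * r * B / sqrt (real n) + sqrt (ln (1 / \<delta>) / (2 * real n)))}"
    (is "_ \<le> measure _ {s \<in> _. \<forall>f\<in>F. ?Q f s}")
proof (cases "F = {}")
  case True
  interpret N: prob_space "iid M n" by (rule prob_space_iid)
  show ?thesis using True \<delta> N.prob_space by simp
next
  case False
  interpret N: prob_space "iid M n" by (rule prob_space_iid)
  define m where "m = (\<lambda>f. \<integral>z. G f z \<partial>M)"
  define f' where "f' = (\<lambda>s. MAX f\<in>F. (\<Sum>i<n. m f - G f (s i)))"
  \<comment> \<open>The solution of \<open>exp (- 2 * t^2 / n) = \<delta>\<close>.\<close>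
  define t where "t = sqrt (real n * ln (1 / \<delta>) / 2)"
  have t: "t > 0" using n \<delta> by (simp add: t_def)
  have comp: "(\<lambda>s. G f (s i)) \<in> borel_measurable (iid M n)" if "f \<in> F" "i < n" for f i
    using that by (intro iid_component_measurable G_meas)
  have f'_meas: "f' \<in> borel_measurable (iid M n)"
    unfolding f'_def by (intro borel_measurable_Max F borel_measurable_diff
        borel_measurable_sum borel_measurable_const comp) auto
  have space_n: "s i \<in> space M" if "s \<in> space (iid M n)" "i < n" for s i
    using that by (auto simp: space_PiM)
  have m_range: "0 \<le> m f" "m f \<le> 1" if "f \<in> F" for f
  proof -
    have "integrable M (G f)"
      using G_range[OF that] by (intro integrable_bounded_real[of _ 1] G_meas that) auto
    then show "0 \<le> m f" "m f \<le> 1"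
      unfolding m_def using G_range[OF that] by (auto intro!: integral_ge_const integral_le_const)
  qed
  have mem: "\<exists>f\<in>F. f' s = (\<Sum>i<n. m f - G f (s i))" for s
  proof -
    have "f' s \<in> (\<lambda>f. \<Sum>i<n. m f - G f (s i)) ` F"
      unfolding f'_def using F False by (intro Max_in) auto
    then show ?thesis by auto
  qed
  have ge: "(\<Sum>i<n. m f - G f (s i)) \<le> f' s" if "f \<in> F" for f s
    unfolding f'_def using F that by (intro Max_ge) auto
  have f'_bd: "\<bar>f' s\<bar> \<le> real n" if s: "s \<in> space (iid M n)" for s
  proof -
    obtain f where f: "f \<in> F" "f' s = (\<Sum>i<n. m f - G f (s i))" using mem by blast
    have "\<bar>f' s\<bar> \<le> (\<Sum>i<n. \<bar>m f - G f (s i)\<bar>)"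
      unfolding f(2) by (rule sum_abs)
    also have "\<dots> \<le> (\<Sum>i<n. 1)"
    proof (rule sum_mono)
      fix i assume "i \<in> {..<n}"
      then have "0 \<le> G f (s i)" "G f (s i) \<le> 1"
        using G_range[OF f(1) space_n[OF s, of i]] by auto
      then show "\<bar>m f - G f (s i)\<bar> \<le> 1"
        using m_range[OF f(1)] by auto
    qed
    finally show ?thesis by simp
  qed
  \<comment> \<open>One direction suffices, as it is applied with the two samples in either order.
    The maximiser for \<open>s\<close> is a candidate for \<open>s'\<close>, and its two sums differ
    in a single loss term.\<close>
  have upd_le: "f' s \<le> f' s' + 1"
    if "s \<in> space (iid M n)" "s' \<in> space (iid M n)" "i < n" and eq: "\<And>j. j \<noteq> i \<Longrightarrow> s j = s' j" for s s' i
  proof -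
    obtain f where f: "f \<in> F" "f' s = (\<Sum>i<n. m f - G f (s i))" using mem by blast
    have "(\<Sum>i<n. m f - G f (s i)) - (\<Sum>i<n. m f - G f (s' i)) = (\<Sum>j<n. G f (s' j) - G f (s j))"
      by (simp add: sum_subtractf)
    also have "\<dots> = (\<Sum>j<n. if j = i then G f (s' i) - G f (s i) else 0)"
      by (intro sum.cong) (auto simp: eq)
    also have "\<dots> = G f (s' i) - G f (s i)"
      using that(3) by simp
    also have "\<dots> \<le> 1"
      using G_range[OF f(1) space_n[OF that(1,3)]] G_range[OF f(1) space_n[OF that(2,3)]] by linarith
    finally show ?thesis
      using ge[OF f(1), of s'] f(2) by linarith
  qed
  have diff: "\<bar>f' (s(i := z)) - f' s\<bar> \<le> 1" if "s \<in> space (iid M n)" "i < n" "z \<in> space M" for s i z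
  proof -
    have s': "s(i := z) \<in> space (iid M n)"
      using that by (auto simp: space_PiM PiE_iff extensional_def)
    have "f' (s(i := z)) \<le> f' s + 1" "f' s \<le> f' (s(i := z)) + 1"
      by (rule upd_le[of _ _ i]; use that s' in simp)+
    then show ?thesis by linarith
  qed
  define e where "e = (\<integral>s. f' s \<partial>iid M n)"
  have e: "e \<le> 2 * real (card Y) * L * r * B * sqrt (real n)"
  proof -
    \<comment> \<open>In the direction 0 the linear part vanishes and the pure deviation remains;
      all of the square root comes from the n perturbations.\<close>
    have "e \<le> B * sqrt ((\<Sum>j\<in>J. 0\<^sup>2) + real n * (2 * real (card Y) * L * r)\<^sup>2)"
      using expected_MAX_deviation_le[where v = "\<lambda>_. 0" and n = n, OF F False J Y G_meas G_range u_meas u_norm w_norm L lip]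
      by (simp add: e_def f'_def m_def)
    also have "\<dots> = B * (sqrt (real n) * (2 * real (card Y) * L * r))"
      using L r by (simp add: real_sqrt_mult)
    finally show ?thesis by (simp add: mult_ac)
  qed
  have "measure (iid M n) {s \<in> space (iid M n). f' s \<ge> e + t} \<le> exp (- 2 * t\<^sup>2 / real n)"
    unfolding e_def by (rule bounded_differences_tail[OF f'_meas f'_bd diff n t])
  also have "- 2 * t\<^sup>2 / real n = ln \<delta>"
  proof -
    have "t\<^sup>2 = real n * ln (1 / \<delta>) / 2"
      unfolding t_def using \<delta> by (intro real_sqrt_pow2 divide_nonneg_nonneg mult_nonneg_nonneg) auto
    then show ?thesis
      using n \<delta> by (simp add: ln_div)
  qed
  finally have "measure (iid M n) {s \<in> space (iid M n). f' s \<ge> e + t} \<le> \<delta>"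
    using \<delta> by simp
  moreover have "{s \<in> space (iid M n). f' s \<ge> e + t} \<in> sets (iid M n)"
    using f'_meas by measurable
  ultimately have "1 - \<delta> \<le> measure (iid M n) (space (iid M n) - {s \<in> space (iid M n). f' s \<ge> e + t})"
    by (simp add: N.prob_compl)
  also have "\<dots> \<le> measure (iid M n) {s \<in> space (iid M n). \<forall>f\<in>F. ?Q f s}"
  proof (rule N.finite_measure_mono)
    have tn: "t / real n = sqrt (ln (1 / \<delta>) / (2 * real n))"
    proof -
      have "t / real n = sqrt (real n * ln (1 / \<delta>) / 2 / (real n)\<^sup>2)"
        unfolding t_def real_sqrt_divide[of _ "(real n)\<^sup>2"] by simp
      also have "real n * ln (1 / \<delta>) / 2 / (real n)\<^sup>2 = ln (1 / \<delta>) / (2 * real n)"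
        using n by (simp add: power2_eq_square field_simps)
      finally show ?thesis .
    qed
    have "?Q f s" if s: "f' s < e + t" and f: "f \<in> F" for f s
    proof -
      have "real n * m f - (\<Sum>i<n. G f (s i)) < e + t"
        using ge[OF f, of s] s by (simp add: sum_subtractf)
      then have "m f < ((\<Sum>i<n. G f (s i)) + (e + t)) / real n"
        using n by (simp add: pos_less_divide_eq mult.commute)
      then have "m f < 1 / real n * (\<Sum>i<n. G f (s i)) + (e / real n + t / real n)"
        by (simp add: add_divide_distrib)
      moreover have "e / real n \<le> 2 * real (card Y) * L * r * B * sqrt (real n) / real n"
        using e n by (intro divide_right_mono) auto
      moreover have "2 * real (card Y) * L * r * B * sqrt (real n) / real n = 2 * real (card Y) * L * r * B / sqrt (real n)"
        using n by (simp add: field_simps)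
      ultimately show ?thesis
        unfolding m_def tn by linarith
    qed
    then show "space (iid M n) - {s \<in> space (iid M n). f' s \<ge> e + t} \<subseteq> {s \<in> space (iid M n). \<forall>f\<in>F. ?Q f s}"
      by auto
    show "{s \<in> space (iid M n). \<forall>f\<in>F. ?Q f s} \<in> sets (iid M n)"
    proof (rule sets.sets_Collect_finite_All[OF _ F])
      fix f assume f: "f \<in> F"
      have "(\<lambda>s. 1 / real n * (\<Sum>i<n. G f (s i)) + (2 * real (card Y) * L * r * B / sqrt (real n) + sqrt (ln (1 / \<delta>) / (2 * real n)))) \<in> borel_measurable (iid M n)"
        by (intro borel_measurable_add borel_measurable_times borel_measurable_const borel_measurable_sum comp f) auto
      then show "{s \<in> space (iid M n). ?Q f s} \<in> sets (iid M n)"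
        by measurable
    qed
  qed
  finally show ?thesis .
qed

end

subsection \<open>Uniform margin bound for norm-bounded scores\<close>

definition score :: "(nat \<Rightarrow> 'x \<Rightarrow> real) \<Rightarrow> nat \<Rightarrow> (nat \<Rightarrow> nat \<Rightarrow> real) \<Rightarrow> 'x \<Rightarrow> nat \<Rightarrow> real" where
  "score \<psi> N w x y = (\<Sum>k<N. w y k * \<psi> k x)"

text \<open>Only the coordinates below \<open>N\<close> of the labels 1 to c are constrained. A
  single weight function can thus belong to the balls for all \<open>N\<close>, which says that its
  total squared length is at most \<open>B^2\<close>.\<close>

definition weight_ball :: "nat \<Rightarrow> real \<Rightarrow> nat \<Rightarrow> (nat \<Rightarrow> nat \<Rightarrow> real) set" where
  "weight_ball c B N = {w. (\<Sum>y\<in>{1..c}. \<Sum>k<N. (w y k)\<^sup>2) \<le> B\<^sup>2}"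

lemma score_measurable:
  assumes "\<And>k. \<psi> k \<in> borel_measurable borel"
  shows "(\<lambda>x. score \<psi> N w x y) \<in> borel_measurable borel"
  unfolding score_def using assms by (intro borel_measurable_sum borel_measurable_times) auto

locale margin_class = prob_space P
  for P :: "('x::second_countable_topology \<times> nat) measure" +
  fixes c n :: nat and \<gamma> B r \<delta> :: real and \<psi> :: "nat \<Rightarrow> 'x \<Rightarrow> real"
  assumes sets_P: "sets P = sets (borel :: ('x \<times> nat) measure)"
    and c: "c \<ge> 2" and n: "n > 0" and \<gamma>: "\<gamma> > 0" and B: "B \<ge> 0" and r: "r \<ge> 0"
    and \<delta>: "0 < \<delta>" "\<delta> < 1"
    and \<psi>_meas: "\<And>k. \<psi> k \<in> borel_measurable borel"
    and \<psi>_norm: "\<And>x N. (\<Sum>k<N. (\<psi> k x)\<^sup>2) \<le> r\<^sup>2"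
begin

text \<open>Mean deviation for Lipschitz constant \<open>1 / \<gamma>\<close>, plus the
  concentration term at confidence \<open>\<delta>\<close>.\<close>

definition slack :: real where
  "slack = 2 * real c * r * B / (\<gamma> * sqrt (real n)) + sqrt (ln (1 / \<delta>) / (2 * real n))"

definition bound_holds :: "('x \<Rightarrow> nat \<Rightarrow> real) \<Rightarrow> (nat \<Rightarrow> 'x \<times> nat) \<Rightarrow> bool" where
  "bound_holds h s \<longleftrightarrow> (\<integral>p. margin_loss c \<gamma> h p \<partial>P) \<le> 1 / real n * (\<Sum>i<n. margin_loss c \<gamma> h (s i)) + slack"

lemma loss_measurable: "margin_loss c \<gamma> (score \<psi> N w) \<in> borel_measurable P"
  by (intro margin_loss_measurable[OF sets_P] score_measurable \<psi>_meas)

lemma bound_holds_event: "{s \<in> space (iid P n). bound_holds (score \<psi> N w) s} \<in> sets (iid P n)"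
proof -
  have "(\<lambda>s. margin_loss c \<gamma> (score \<psi> N w) (s i)) \<in> borel_measurable (iid P n)" if "i < n" for i
    by (rule iid_component_measurable[OF loss_measurable that])
  then have "(\<lambda>s. 1 / real n * (\<Sum>i<n. margin_loss c \<gamma> (score \<psi> N w) (s i)) + slack) \<in> borel_measurable (iid P n)"
    by (intro borel_measurable_add borel_measurable_times borel_measurable_const borel_measurable_sum) auto
  then show ?thesis
    unfolding bound_holds_def by measurable
qed

text \<open>All c scores become linear functionals of one vector: the weights of the labels are laid
  side by side in blocks, and \<open>u z y\<close> puts the features of the point into block
  \<open>y\<close>. The length of \<open>u z y\<close> is then that of the features, and the length
  of the weights is the total over all labels.\<close>

lemma finite_bound:
  assumes F: "finite F" "\<And>N w. (N, w) \<in> F \<Longrightarrow> w \<in> weight_ball c B N"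
  shows "1 - \<delta> \<le> measure (iid P n) {s \<in> space (iid P n). \<forall>(N, w)\<in>F. bound_holds (score \<psi> N w) s}"
proof -
  \<comment> \<open>A common truncation length for the class; shorter weights are padded with 0 by
    \<open>w'\<close>. The inserted 0 covers the empty class.\<close>
  define K where "K = Max (insert 0 (fst ` F))"
  have K: "fst f \<le> K" if "f \<in> F" for f
    unfolding K_def using F(1) that by (intro Max_ge) auto
  define J where "J = {1..c} \<times> {..<K}"
  define u where "u = (\<lambda>(z :: 'x \<times> nat) (y :: nat) (j :: nat \<times> nat). if fst j = y then \<psi> (snd j) (fst z) else 0)"
  define w' where "w' = (\<lambda>(f :: nat \<times> (nat \<Rightarrow> nat \<Rightarrow> real)) (j :: nat \<times> nat). if snd j < fst f then snd f (fst j) (snd j) else 0)"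
  define G where "G = (\<lambda>f. margin_loss c \<gamma> (score \<psi> (fst f) (snd f)))"
  have inner: "(\<Sum>j\<in>J. w' f j * u z y j) = score \<psi> (fst f) (snd f) (fst z) y" if f: "f \<in> F" and y: "y \<in> {1..c}" for f z y
  proof -
    have "(\<Sum>j\<in>J. w' f j * u z y j) = (\<Sum>y'\<in>{1..c}. \<Sum>k<K. w' f (y', k) * u z y (y', k))"
      unfolding J_def by (simp add: sum.cartesian_product split_beta')
    also have "\<dots> = (\<Sum>y'\<in>{1..c}. if y' = y then \<Sum>k<K. w' f (y, k) * \<psi> k (fst z) else 0)"
      by (intro sum.cong) (auto simp: u_def)
    also have "\<dots> = (\<Sum>k<K. w' f (y, k) * \<psi> k (fst z))"
      using y by simp
    also have "\<dots> = (\<Sum>k<fst f. w' f (y, k) * \<psi> k (fst z))"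
      using K[OF f] by (intro sum.mono_neutral_right) (auto simp: w'_def)
    also have "\<dots> = score \<psi> (fst f) (snd f) (fst z) y"
      unfolding score_def by (intro sum.cong) (auto simp: w'_def)
    finally show ?thesis .
  qed
  have "1 - \<delta> \<le> measure (iid P n) {s \<in> space (iid P n). \<forall>f\<in>F. (\<integral>z. G f z \<partial>P)
    \<le> 1 / real n * (\<Sum>i<n. G f (s i)) + (2 * real (card {1..c}) * (1 / \<gamma>) * r * B / sqrt (real n) + sqrt (ln (1 / \<delta>) / (2 * real n)))}"
  proof (rule finite_class_deviation[where J = J and u = u and w = w'])
    show "finite F" by fact
    show "finite J" by (simp add: J_def)
    show "G f \<in> borel_measurable P" for f
      unfolding G_def by (rule loss_measurable)
    show "0 \<le> G f z \<and> G f z \<le> 1" for f z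
      by (simp add: G_def margin_loss_range)
    show "(\<lambda>z. u z y j) \<in> borel_measurable P" for y j
    proof -
      have "(\<lambda>z :: 'x \<times> nat. \<psi> (snd j) (fst z)) \<in> borel_measurable borel"
        by (rule measurable_compose[OF _ \<psi>_meas]) (intro borel_measurable_continuous_onI continuous_intros)
      then show ?thesis
        unfolding u_def measurable_cong_sets[OF sets_P refl] by (cases "fst j = y") auto
    qed
    show "L2_set (u z y) J \<le> r" if y: "y \<in> {1..c}" for z y
    proof -
      have "(\<Sum>j\<in>J. (u z y j)\<^sup>2) = (\<Sum>y'\<in>{1..c}. \<Sum>k<K. (u z y (y', k))\<^sup>2)"
        unfolding J_def by (simp add: sum.cartesian_product split_beta')
      also have "\<dots> = (\<Sum>y'\<in>{1..c}. if y' = y then \<Sum>k<K. (\<psi> k (fst z))\<^sup>2 else 0)"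
        by (intro sum.cong) (auto simp: u_def)
      also have "\<dots> \<le> r\<^sup>2"
        using y \<psi>_norm by simp
      finally show ?thesis
        unfolding L2_set_def using r by (rule real_le_lsqrt[rotated])
    qed
    show "L2_set (w' f) J \<le> B" if f: "f \<in> F" for f
    proof -
      have "(\<Sum>j\<in>J. (w' f j)\<^sup>2) = (\<Sum>y\<in>{1..c}. \<Sum>k<K. (w' f (y, k))\<^sup>2)"
        unfolding J_def by (simp add: sum.cartesian_product split_beta')
      also have "\<dots> = (\<Sum>y\<in>{1..c}. \<Sum>k<fst f. (w' f (y, k))\<^sup>2)"
        using K[OF f] by (intro sum.cong refl sum.mono_neutral_right) (auto simp: w'_def)
      also have "\<dots> = (\<Sum>y\<in>{1..c}. \<Sum>k<fst f. (snd f y k)\<^sup>2)"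
        by (intro sum.cong) (auto simp: w'_def)
      also have "\<dots> \<le> B\<^sup>2"
        using F(2)[of "fst f" "snd f"] f by (simp add: weight_ball_def)
      finally show ?thesis
        unfolding L2_set_def using B by (rule real_le_lsqrt[rotated])
    qed
    show "\<bar>G f z - G g z\<bar> \<le> 1 / \<gamma> * (\<Sum>y\<in>{1..c}. \<bar>(\<Sum>j\<in>J. w' f j * u z y j) - (\<Sum>j\<in>J. w' g j * u z y j)\<bar>)"
      if "f \<in> F" "g \<in> F" for f g z
      unfolding G_def using that inner
      by (intro order_trans[OF margin_loss_lipschitz[OF c \<gamma>]]) (simp add: inner)
  qed (use c \<gamma> r n \<delta> in auto)
  then show ?thesis
    by (simp add: bound_holds_def slack_def G_def split_beta' add.assoc)
qed

lemma uniform_bound: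
  "\<exists>E\<in>sets (iid P n). 1 - \<delta> \<le> measure (iid P n) E \<and>
     (\<forall>s\<in>E. \<forall>N. \<forall>w\<in>weight_ball c B N. bound_holds (score \<psi> N w) s)"
proof -
  \<comment> \<open>Weights live in a countable product of real lines, a second countable metric
    space. Convergence there is coordinatewise, which is enough for scores that are finite
    sums.\<close>
  have "\<exists>T. countable T \<and> T \<subseteq> weight_ball c B N \<and> weight_ball c B N \<subseteq> closure T" for N
    by (rule separable[of "weight_ball c B N"]) blast
  then obtain T where T: "\<And>N. countable (T N)" "\<And>N. T N \<subseteq> weight_ball c B N"
      "\<And>N. weight_ball c B N \<subseteq> closure (T N)"
    by metis
  define D where "D = (SIGMA N:UNIV. T N)"
  define E where "E = {s \<in> space (iid P n). \<forall>f\<in>D. bound_holds (score \<psi> (fst f) (snd f)) s}"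
  interpret N: prob_space "iid P n" by (rule prob_space_iid)
  have D: "countable D" unfolding D_def using T(1) by auto
  have fin: "1 - \<delta> \<le> measure (iid P n) {s \<in> space (iid P n). \<forall>f\<in>F. bound_holds (score \<psi> (fst f) (snd f)) s}"
    if "finite F" "F \<subseteq> D" for F
    using finite_bound[OF that(1)] that(2) T(2) by (force simp: D_def split_beta')
  have E: "E \<in> sets (iid P n)" "1 - \<delta> \<le> measure (iid P n) E"
    unfolding E_def
    by (rule N.prob_countable_family[OF D bound_holds_event fin]; assumption)+
  have "bound_holds (score \<psi> N w) s" if s: "s \<in> E" and w: "w \<in> weight_ball c B N" for s N w
  proof -
    obtain ws where ws: "\<And>k. ws k \<in> T N" "ws \<longlonglongrightarrow> w"
      using subsetD[OF T(3) w] unfolding closure_sequential by blast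
    have coord: "(\<lambda>k. ws k y j) \<longlonglongrightarrow> w y j" for y j
    proof -
      have "continuous_on UNIV (\<lambda>v :: nat \<Rightarrow> nat \<Rightarrow> real. v y j)"
        by (rule continuous_on_product_then_coordinatewise[OF continuous_on_product_coordinates])
      from continuous_on_tendsto_compose[OF this ws(2)] show ?thesis
        by simp
    qed
    have lim: "(\<lambda>k. score \<psi> N (ws k) x y) \<longlonglongrightarrow> score \<psi> N w x y" for x y
      unfolding score_def by (intro tendsto_sum tendsto_mult_right coord)
    have "bound_holds (score \<psi> N (ws k)) s" for k
      using s ws(1) by (force simp: E_def D_def)
    then show ?thesis
      unfolding bound_holds_def
      by (rule risk_bound_limit[where h = "\<lambda>k. score \<psi> N (ws k)", OF prob_space_axioms sets_P c \<gamma> score_measurable[OF \<psi>_meas] lim])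
  qed
  with E show ?thesis by blast
qed

text \<open>Square summable weights are reached as limits of their truncations, so that only pointwise
  convergence of the scores is required.\<close>

lemma bound_holds_limit:
  assumes w: "\<And>N. w \<in> weight_ball c B N"
    and lim: "\<And>x y. y \<in> {1..c} \<Longrightarrow> (\<lambda>N. score \<psi> N w x y) \<longlonglongrightarrow> h x y"
    and s: "\<And>N w. w \<in> weight_ball c B N \<Longrightarrow> bound_holds (score \<psi> N w) s"
  shows "bound_holds h s"
  unfolding bound_holds_def
  by (rule risk_bound_limit[where h = "\<lambda>N. score \<psi> N w", OF prob_space_axioms sets_P c \<gamma> score_measurable[OF \<psi>_meas]])
     (use lim s[OF w] in \<open>auto simp: bound_holds_def\<close>)

end

subsection \<open>Scores of a decomposed kernel\<close>

text \<open>Both kernel parts share one feature sequence, and \<open>pos\<close> tells to which part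
  an index belongs. Vanishing outside \<open>X\<close> makes the norm bound and the convergence of
  scores hold at every point.\<close>

locale kernel_features =
  fixes X :: "'x set" and Sp Sm :: "'x \<Rightarrow> 'x \<Rightarrow> real" and pos :: "nat \<Rightarrow> bool" and \<psi> :: "nat \<Rightarrow> 'x \<Rightarrow> real"
  assumes plus: "\<And>x t. x \<in> X \<Longrightarrow> t \<in> X \<Longrightarrow> (\<lambda>k. if pos k then \<psi> k x * \<psi> k t else 0) sums Sp x t"
    and minus: "\<And>x t. x \<in> X \<Longrightarrow> t \<in> X \<Longrightarrow> (\<lambda>k. if pos k then 0 else \<psi> k x * \<psi> k t) sums Sm x t"
    and outside: "\<And>x k. x \<notin> X \<Longrightarrow> \<psi> k x = 0"
begin

text \<open>The minus sign of the negative part is put into the weights, where squaring removes it,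
  so the indefinite kernel needs no indefinite norm.\<close>

definition weights :: "(nat \<Rightarrow> real) \<Rightarrow> nat \<Rightarrow> (nat \<Rightarrow> 'x \<times> nat) \<Rightarrow> nat \<Rightarrow> nat \<Rightarrow> real" where
  "weights \<alpha> n s y k = (if pos k then 1 else -1) * (\<Sum>i<n. (if snd (s i) = y then \<alpha> i else 0) * \<psi> k (fst (s i)))"

text \<open>Adding the two diagonal series, rather than subtracting them, gives all squared
  features; their sum is at most \<open>2 * R^2\<close>.\<close>

lemma sum_square_features_le:
  assumes Sp: "\<And>x. x \<in> X \<Longrightarrow> Sp x x \<le> R\<^sup>2" and Sm: "\<And>x. x \<in> X \<Longrightarrow> Sm x x \<le> R\<^sup>2"
  shows "(\<Sum>k<N. (\<psi> k x)\<^sup>2) \<le> (sqrt 2 * R)\<^sup>2"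
proof (cases "x \<in> X")
  case True
  have "(\<lambda>k. (if pos k then \<psi> k x * \<psi> k x else 0) + (if pos k then 0 else \<psi> k x * \<psi> k x)) sums (Sp x x + Sm x x)"
    by (intro sums_add plus minus True)
  moreover have "(\<lambda>k. (if pos k then \<psi> k x * \<psi> k x else 0) + (if pos k then 0 else \<psi> k x * \<psi> k x)) = (\<lambda>k. (\<psi> k x)\<^sup>2)"
    by (auto simp: power2_eq_square)
  ultimately have sums: "(\<lambda>k. (\<psi> k x)\<^sup>2) sums (Sp x x + Sm x x)"
    by simp
  have "(\<Sum>k<N. (\<psi> k x)\<^sup>2) \<le> Sp x x + Sm x x"
    using sum_le_suminf[OF sums_summable[OF sums], of "{..<N}"] sums_unique[OF sums] by simp
  with Sp[OF True] Sm[OF True] show ?thesis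
    by (simp add: power_mult_distrib)
qed (simp add: outside)

text \<open>Expanding the kernels in features turns each \<open>Omega\<close> into the squared
  lengths of the weights over its own indices, so the two together are the total over all labels.
  The radius \<open>Bp + Bm\<close> results from adding the nonnegative cross term to
  \<open>Bp^2 + Bm^2\<close>.\<close>

lemma weights_in_ball:
  assumes s: "\<And>i. i < n \<Longrightarrow> fst (s i) \<in> X"
    and "Omega Sp c \<alpha> n s \<le> Bp\<^sup>2" "Omega Sm c \<alpha> n s \<le> Bm\<^sup>2" "Bp \<ge> 0" "Bm \<ge> 0"
  shows "weights \<alpha> n s \<in> weight_ball c (Bp + Bm) N"
proof -
  define a where "a = (\<lambda>y i. if snd (s i) = y then \<alpha> i else 0)"
  define x where "x = (\<lambda>i. fst (s i))"
  have x: "x i \<in> X" if "i < n" for i using s that by (simp add: x_def)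
  define gp where "gp = (\<lambda>k. \<Sum>y\<in>{1..c}. \<Sum>i<n. \<Sum>j<n. a y i * (if pos k then \<psi> k (x i) * \<psi> k (x j) else 0) * a y j)"
  define gm where "gm = (\<lambda>k. \<Sum>y\<in>{1..c}. \<Sum>i<n. \<Sum>j<n. a y i * (if pos k then 0 else \<psi> k (x i) * \<psi> k (x j)) * a y j)"
  have "gp sums Omega Sp c \<alpha> n s"
    unfolding gp_def Omega_def a_def x_def using s
    by (intro sums_sum sums_mult sums_mult2 plus) auto
  moreover have "gm sums Omega Sm c \<alpha> n s"
    unfolding gm_def Omega_def a_def x_def using s
    by (intro sums_sum sums_mult sums_mult2 minus) auto
  ultimately have "(\<lambda>k. gp k + gm k) sums (Omega Sp c \<alpha> n s + Omega Sm c \<alpha> n s)"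
    by (rule sums_add)
  moreover have "gp k + gm k = (\<Sum>y\<in>{1..c}. (weights \<alpha> n s y k)\<^sup>2)" for k
  proof -
    have "gp k + gm k = (\<Sum>y\<in>{1..c}. \<Sum>i<n. \<Sum>j<n. (a y i * \<psi> k (x i)) * (a y j * \<psi> k (x j)))"
      by (cases "pos k") (simp_all add: gp_def gm_def mult_ac)
    also have "\<dots> = (\<Sum>y\<in>{1..c}. (\<Sum>i<n. a y i * \<psi> k (x i))\<^sup>2)"
      by (simp add: power2_eq_square sum_product)
    also have "\<dots> = (\<Sum>y\<in>{1..c}. (weights \<alpha> n s y k)\<^sup>2)"
      by (simp add: weights_def a_def x_def)
    finally show ?thesis .
  qed
  ultimately have sums: "(\<lambda>k. \<Sum>y\<in>{1..c}. (weights \<alpha> n s y k)\<^sup>2) sums (Omega Sp c \<alpha> n s + Omega Sm c \<alpha> n s)"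
    by simp
  have "(\<Sum>y\<in>{1..c}. \<Sum>k<N. (weights \<alpha> n s y k)\<^sup>2) = (\<Sum>k<N. \<Sum>y\<in>{1..c}. (weights \<alpha> n s y k)\<^sup>2)"
    by (rule sum.swap)
  also have "\<dots> \<le> Omega Sp c \<alpha> n s + Omega Sm c \<alpha> n s"
    using sum_le_suminf[OF sums_summable[OF sums], of "{..<N}"] sums_unique[OF sums] by (simp add: sum_nonneg)
  also have "\<dots> \<le> Bp\<^sup>2 + Bm\<^sup>2"
    using assms by simp
  also have "\<dots> \<le> (Bp + Bm)\<^sup>2"
    using assms by (simp add: power2_sum)
  finally show ?thesis
    by (simp add: weight_ball_def)
qed

lemma score_weights_tendsto:
  assumes s: "\<And>i. i < n \<Longrightarrow> fst (s i) \<in> X"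
    and S: "\<And>x t. x \<in> X \<Longrightarrow> t \<in> X \<Longrightarrow> S x t = Sp x t - Sm x t"
  shows "(\<lambda>N. score \<psi> N (weights \<alpha> n s) x y) \<longlonglongrightarrow> (if x \<in> X then hS S \<alpha> n s x y else 0)"
proof (cases "x \<in> X")
  case True
  define e :: "nat \<Rightarrow> real" where "e = (\<lambda>k. if pos k then 1 else -1)"
  have ker: "(\<lambda>N. \<Sum>k<N. e k * (\<psi> k x * \<psi> k (fst (s i)))) \<longlonglongrightarrow> S x (fst (s i))" if "i < n" for i
  proof -
    have "(\<lambda>k. (if pos k then \<psi> k x * \<psi> k (fst (s i)) else 0) - (if pos k then 0 else \<psi> k x * \<psi> k (fst (s i))))
        sums (Sp x (fst (s i)) - Sm x (fst (s i)))"
      by (intro sums_diff plus minus True s that)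
    moreover have "(\<lambda>k. (if pos k then \<psi> k x * \<psi> k (fst (s i)) else 0) - (if pos k then 0 else \<psi> k x * \<psi> k (fst (s i))))
        = (\<lambda>k. e k * (\<psi> k x * \<psi> k (fst (s i))))"
      by (auto simp: e_def)
    ultimately show ?thesis
      using S[OF True s[OF that]] by (simp add: sums_def)
  qed
  have "score \<psi> N (weights \<alpha> n s) x y
      = (\<Sum>i<n. (if snd (s i) = y then \<alpha> i else 0) * (\<Sum>k<N. e k * (\<psi> k x * \<psi> k (fst (s i)))))" for N
  proof -
    have "score \<psi> N (weights \<alpha> n s) x y
        = (\<Sum>k<N. \<Sum>i<n. (if snd (s i) = y then \<alpha> i else 0) * (e k * (\<psi> k x * \<psi> k (fst (s i)))))"
      by (simp only: score_def weights_def e_def sum_distrib_left sum_distrib_right mult_ac)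
    also have "\<dots> = (\<Sum>i<n. \<Sum>k<N. (if snd (s i) = y then \<alpha> i else 0) * (e k * (\<psi> k x * \<psi> k (fst (s i)))))"
      by (rule sum.swap)
    finally show ?thesis
      by (simp only: sum_distrib_left)
  qed
  moreover have "(\<lambda>N. \<Sum>i<n. (if snd (s i) = y then \<alpha> i else 0) * (\<Sum>k<N. e k * (\<psi> k x * \<psi> k (fst (s i)))))
      \<longlonglongrightarrow> (\<Sum>i<n. (if snd (s i) = y then \<alpha> i else 0) * S x (fst (s i)))"
    by (intro tendsto_sum tendsto_mult_left ker) auto
  moreover have "(\<Sum>i<n. (if snd (s i) = y then \<alpha> i else 0) * S x (fst (s i))) = hS S \<alpha> n s x y"
    unfolding hS_def by (intro sum.cong) auto
  ultimately show ?thesis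
    using True by simp
next
  case False
  then show ?thesis by (simp add: score_def outside)
qed

end

section \<open>From the margin loss to the misclassification risk\<close>

lemma fS_argmax:
  assumes "c \<ge> 1"
  shows "fS c S \<alpha> n s x \<in> {1..c}" "y \<in> {1..c} \<Longrightarrow> hS S \<alpha> n s x y \<le> hS S \<alpha> n s x (fS c S \<alpha> n s x)"
proof -
  let ?h = "hS S \<alpha> n s x"
  have ne: "{1..c} \<noteq> {}" using assms by simp
  have "Max (?h ` {1..c}) \<in> ?h ` {1..c}" using ne by (intro Max_in) auto
  then obtain z where z: "z \<in> {1..c}" "?h z = Max (?h ` {1..c})" by auto
  have "z \<in> {1..c} \<and> (\<forall>y'\<in>{1..c}. ?h y' \<le> ?h z)"
    unfolding z(2) using z(1) by (auto intro!: Max_ge)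
  then have *: "fS c S \<alpha> n s x \<in> {1..c} \<and> (\<forall>y'\<in>{1..c}. ?h y' \<le> ?h (fS c S \<alpha> n s x))"
    unfolding fS_def by (rule LeastI)
  show "fS c S \<alpha> n s x \<in> {1..c}" using * by blast
  show "?h y \<le> ?h (fS c S \<alpha> n s x)" if "y \<in> {1..c}" using * that by blast
qed

text \<open>The predicted label is one of the competitors of \<open>y\<close> and scores at least as
  high, ties included; the margin is therefore not positive, where \<open>Phi\<close> equals
  1.\<close>

lemma margin_loss_misclassified:
  assumes c: "c \<ge> 1" and \<gamma>: "\<gamma> > 0" and y: "y \<in> {1..c}" "y \<noteq> fS c S \<alpha> n s x"
    and h: "\<And>y. h x y = hS S \<alpha> n s x y"
  shows "margin_loss c \<gamma> h (x, y) = 1"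
proof -
  let ?z = "fS c S \<alpha> n s x"
  have "h x ?z \<le> Max ((\<lambda>y'. h x y') ` ({1..c} - {y}))"
    using fS_argmax(1)[OF c, of S \<alpha> n s x] y(2) by (intro Max_ge imageI) auto
  moreover have "h x y \<le> h x ?z"
    using fS_argmax(2)[OF c y(1)] by (simp add: h)
  ultimately have "(h x y - Max ((\<lambda>y'. h x y') ` ({1..c} - {y}))) / \<gamma> \<le> 0"
    using \<gamma> by (simp add: divide_le_0_iff)
  then show ?thesis
    using y(1) by (simp add: margin_loss_def Phi_def)
qed

lemma true_risk_le_margin_loss:
  assumes P: "prob_space P" and supp: "measure P (X \<times> {1..c}) = 1"
    and c: "c \<ge> 1" and \<gamma>: "\<gamma> > 0"
    and meas: "margin_loss c \<gamma> h \<in> borel_measurable P"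
    and h: "\<And>x y. x \<in> X \<Longrightarrow> h x y = hS S \<alpha> n s x y"
  shows "true_risk P (fS c S \<alpha> n s) \<le> (\<integral>p. margin_loss c \<gamma> h p \<partial>P)"
proof -
  interpret prob_space P by fact
  define A where "A = {p \<in> space P. snd p \<noteq> fS c S \<alpha> n s (fst p)}"
  show ?thesis
  proof (cases "A \<in> events")
    case True
    have "X \<times> {1..c} \<in> events"
      using supp measure_notin_sets by force
    then have AE: "AE p in P. p \<in> X \<times> {1..c}"
      using supp prob_eq_1 by blast
    have "true_risk P (fS c S \<alpha> n s) = (\<integral>p. indicator A p \<partial>P)"
      using True by (simp add: true_risk_def A_def)
    also have "\<dots> \<le> (\<integral>p. margin_loss c \<gamma> h p \<partial>P)"
    proof (rule integral_mono_AE)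
      show "integrable P (margin_loss c \<gamma> h)"
        by (rule integrable_bounded_real[OF meas, of 1]) (simp add: margin_loss_range)
      show "AE p in P. indicator A p \<le> margin_loss c \<gamma> h p"
        using AE
      proof eventually_elim
        case (elim p)
        show ?case
        proof (cases "p \<in> A")
          case True
          then have "margin_loss c \<gamma> h (fst p, snd p) = 1"
            using elim by (intro margin_loss_misclassified[OF c \<gamma>, where S = S and \<alpha> = \<alpha> and n = n and s = s]) (auto simp: A_def h)
          then show ?thesis by simp
        qed (simp add: margin_loss_range)
      qed
    qed (use True in \<open>auto intro!: integrable_bounded_real[of _ 1] split: split_indicator\<close>)
    finally show ?thesis .
  next
    case False
    then have "true_risk P (fS c S \<alpha> n s) = 0"
      by (simp add: true_risk_def A_def[symmetric] measure_notin_sets)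
    then show ?thesis
      by (simp add: margin_loss_range Bochner_Integration.integral_nonneg)
  qed
qed

lemma emp_margin_risk_eq:
  assumes s: "\<And>i. i < n \<Longrightarrow> s i \<in> X \<times> {1..c}"
    and h: "\<And>x y. x \<in> X \<Longrightarrow> h x y = hS S \<alpha> n s x y"
  shows "emp_margin_risk c \<gamma> S \<alpha> n s = 1 / real n * (\<Sum>i<n. margin_loss c \<gamma> h (s i))"
proof -
  have "margin_loss c \<gamma> h (s i) = Phi ((hS S \<alpha> n s (fst (s i)) (snd (s i))
        - Max ((\<lambda>y'. hS S \<alpha> n s (fst (s i)) y') ` ({1..c} - {snd (s i)}))) / \<gamma>)" if "i < n" for i
    using s[OF that] by (auto simp: margin_loss_def h)
  then show ?thesis
    unfolding emp_margin_risk_def by simp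
qed

section \<open>Explicit bound on the empirical margin risk\<close>

lemma Phi_le: "u \<le> 1 \<Longrightarrow> Phi u \<le> 1 - u"
  by (simp add: Phi_def)

lemma emp_margin_risk_le:
  assumes c: "c \<ge> 2" and n: "n > 0" and \<gamma>: "\<gamma> \<ge> 1"
    and s: "\<And>i. i < n \<Longrightarrow> s i \<in> X \<times> {1..c}"
    and \<alpha>: "\<And>i. i < n \<Longrightarrow> \<alpha> i \<ge> 0" "(\<Sum>i<n. \<alpha> i) = 1"
    and sym: "\<And>x t. x \<in> X \<Longrightarrow> t \<in> X \<Longrightarrow> S x t = S t x"
    and range: "\<And>x t. x \<in> X \<Longrightarrow> t \<in> X \<Longrightarrow> 0 \<le> S x t \<and> S x t \<le> 1"
  shows "emp_margin_risk c \<gamma> S \<alpha> n s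
    \<le> 1 - (1 / (real n * \<gamma>)) * (\<Sum>i<n. \<Sum>j<n. (\<alpha> i + \<alpha> j) / 2 * S (fst (s i)) (fst (s j)))
        + (1 / (real n * \<gamma>)) * (\<Sum>i<n. \<Sum>j<n.
            if i < j \<and> snd (s i) \<noteq> snd (s j) then 2 * (\<alpha> i + \<alpha> j) * S (fst (s i)) (fst (s j)) else 0)"
proof -
  define k where "k = (\<lambda>i j. S (fst (s i)) (fst (s j)))"
  define d where "d = (\<lambda>i j. if snd (s i) \<noteq> snd (s j) then k i j else 0)"
  have k_range: "0 \<le> k i j" "k i j \<le> 1" and k_sym: "k i j = k j i" if "i < n" "j < n" for i j
    using s[OF that(1)] s[OF that(2)] range sym by (auto simp: k_def mem_Times_iff)
  have d_sym: "d i j = d j i" if "i < n" "j < n" for i j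
    using k_sym[OF that] by (simp add: d_def)
  have term_le: "Phi ((hS S \<alpha> n s (fst (s i)) (snd (s i))
        - Max ((\<lambda>y'. hS S \<alpha> n s (fst (s i)) y') ` ({1..c} - {snd (s i)}))) / \<gamma>)
      \<le> 1 - ((\<Sum>j<n. \<alpha> j * k i j) - 2 * (\<Sum>j<n. \<alpha> j * d i j)) / \<gamma>" if i: "i < n" for i
  proof -
    define h where "h = hS S \<alpha> n s (fst (s i))"
    define A where "A = {1..c} - {snd (s i)}"
    have h: "h y = (\<Sum>j<n. if snd (s j) = y then \<alpha> j * k i j else 0)" for y
      unfolding h_def hS_def k_def ..
    have nn: "0 \<le> \<alpha> j * k i j" if "j < n" for j
      using \<alpha>(1)[OF that] k_range[OF i that] by simp
    have "(if snd (s i) = 1 then 2 else 1) \<in> A" using c by (simp add: A_def)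
    then have A: "finite A" "A \<noteq> {}" by (auto simp: A_def)
    have "Max (h ` A) \<in> h ` A" using A by (intro Max_in) auto
    then obtain y where y: "y \<in> A" "Max (h ` A) = h y" by auto
    \<comment> \<open>The own score is the total minus the mass \<open>d\<close> on other labels,
      and any competitor has at most that mass. It is thus lost twice, hence the factor 2.\<close>
    have h_own: "h (snd (s i)) = (\<Sum>j<n. \<alpha> j * k i j) - (\<Sum>j<n. \<alpha> j * d i j)"
      unfolding h sum_subtractf[symmetric] by (intro sum.cong) (auto simp: d_def)
    have h_other: "h y \<le> (\<Sum>j<n. \<alpha> j * d i j)"
      unfolding h using y(1) nn by (intro sum_mono) (auto simp: d_def A_def)
    have "h (snd (s i)) \<le> (\<Sum>j<n. \<alpha> j)"
      unfolding h using nn \<alpha>(1) k_range[OF i] by (intro sum_mono) (auto intro: mult_left_le)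
    moreover have "0 \<le> h y"
      unfolding h using nn by (intro sum_nonneg) auto
    ultimately have "h (snd (s i)) - Max (h ` A) \<le> \<gamma>"
      using \<alpha>(2) y(2) \<gamma> by linarith
    \<comment> \<open>Here \<open>\<gamma> \<ge> 1\<close> enters: own scores are at most 1 and
      competing ones nonnegative, so the scaled margin does not exceed 1, the range where
      \<open>Phi u\<close> is at most \<open>1 - u\<close>.\<close>
    then have "Phi ((h (snd (s i)) - Max (h ` A)) / \<gamma>) \<le> 1 - (h (snd (s i)) - Max (h ` A)) / \<gamma>"
      using \<gamma> by (intro Phi_le) simp
    also have "\<dots> \<le> 1 - ((\<Sum>j<n. \<alpha> j * k i j) - 2 * (\<Sum>j<n. \<alpha> j * d i j)) / \<gamma>"
      using h_own h_other y(2) \<gamma> by (intro diff_left_mono divide_right_mono) auto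
    finally show ?thesis
      by (simp add: h_def A_def)
  qed
  have "emp_margin_risk c \<gamma> S \<alpha> n s
      \<le> 1 / real n * (\<Sum>i<n. 1 - ((\<Sum>j<n. \<alpha> j * k i j) - 2 * (\<Sum>j<n. \<alpha> j * d i j)) / \<gamma>)"
    unfolding emp_margin_risk_def by (intro mult_left_mono sum_mono term_le) auto
  also have "\<dots> = 1 - 1 / (real n * \<gamma>) * (\<Sum>i<n. \<Sum>j<n. \<alpha> j * k i j)
      + 1 / (real n * \<gamma>) * (2 * (\<Sum>i<n. \<Sum>j<n. \<alpha> j * d i j))"
    using n \<gamma> by (simp add: sum_subtractf sum_divide_distrib[symmetric] sum_distrib_left[symmetric] sum.distrib field_simps)
  \<comment> \<open>Averaging the double sum with its transpose, by symmetry of the kernel.\<close>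
  also have "(\<Sum>i<n. \<Sum>j<n. \<alpha> j * k i j) = (\<Sum>i<n. \<Sum>j<n. (\<alpha> i + \<alpha> j) / 2 * k i j)"
  proof -
    have "(\<Sum>i<n. \<Sum>j<n. \<alpha> j * k i j) = (\<Sum>i<n. \<Sum>j<n. \<alpha> i * k j i)"
      by (rule sum.swap)
    also have "\<dots> = (\<Sum>i<n. \<Sum>j<n. \<alpha> i * k i j)"
      using k_sym by (intro sum.cong refl) auto
    finally have "2 * (\<Sum>i<n. \<Sum>j<n. \<alpha> j * k i j) = (\<Sum>i<n. \<Sum>j<n. \<alpha> i * k i j + \<alpha> j * k i j)"
      by (simp add: sum.distrib)
    also have "\<dots> = 2 * (\<Sum>i<n. \<Sum>j<n. (\<alpha> i + \<alpha> j) / 2 * k i j)"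
      unfolding sum_distrib_left by (intro sum.cong refl) (simp add: field_simps)
    finally show ?thesis by simp
  qed
  \<comment> \<open>The diagonal of \<open>d\<close> is 0, since a point shares its own label; the
    lower triangle is folded onto the upper one by symmetry.\<close>
  also have "2 * (\<Sum>i<n. \<Sum>j<n. \<alpha> j * d i j) = (\<Sum>i<n. \<Sum>j<n. if i < j then 2 * (\<alpha> i + \<alpha> j) * d i j else 0)"
  proof -
    have "(\<Sum>i<n. \<Sum>j<n. \<alpha> j * d i j)
        = (\<Sum>i<n. \<Sum>j<n. (if i < j then \<alpha> j * d i j else 0) + (if j < i then \<alpha> j * d i j else 0))"
      by (intro sum.cong refl) (auto simp: d_def)
    also have "\<dots> = (\<Sum>i<n. \<Sum>j<n. if i < j then \<alpha> j * d i j else 0) + (\<Sum>i<n. \<Sum>j<n. if j < i then \<alpha> j * d i j else 0)"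
      by (simp add: sum.distrib)
    also have "(\<Sum>i<n. \<Sum>j<n. if j < i then \<alpha> j * d i j else 0) = (\<Sum>i<n. \<Sum>j<n. if i < j then \<alpha> i * d j i else 0)"
      by (rule sum.swap)
    also have "\<dots> = (\<Sum>i<n. \<Sum>j<n. if i < j then \<alpha> i * d i j else 0)"
      using d_sym by (intro sum.cong refl) auto
    also have "(\<Sum>i<n. \<Sum>j<n. if i < j then \<alpha> j * d i j else 0) + (\<Sum>i<n. \<Sum>j<n. if i < j then \<alpha> i * d i j else 0)
        = (\<Sum>i<n. \<Sum>j<n. if i < j then (\<alpha> i + \<alpha> j) * d i j else 0)"
      unfolding sum.distrib[symmetric] by (intro sum.cong refl) (simp add: distrib_right)
    finally show ?thesis
      by (simp only: sum_distrib_left) (intro sum.cong refl, simp)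
  qed
  also have "\<dots> = (\<Sum>i<n. \<Sum>j<n. if i < j \<and> snd (s i) \<noteq> snd (s j) then 2 * (\<alpha> i + \<alpha> j) * k i j else 0)"
    by (intro sum.cong refl) (auto simp: d_def)
  finally show ?thesis
    unfolding k_def .
qed

section \<open>The generalization bound for indefinite kernels\<close>

theorem theorem3p2:
  fixes X :: "(real ^ 'd) set" and c n :: nat and P :: "((real ^ 'd) \<times> nat) measure"
    and S :: "real ^ 'd \<Rightarrow> real ^ 'd \<Rightarrow> real"
    and K :: "nat set" and lam :: "nat \<Rightarrow> real" and phi :: "nat \<Rightarrow> real ^ 'd \<Rightarrow> real"
    and C Bp Bm R \<gamma> \<delta> :: real
  assumes X_compact: "compact X"
    and c_ge: "c \<ge> 2"
    and n_pos: "n > 0"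
    and P_prob: "prob_space P"
    and P_sets: "sets P = sets (borel :: ((real ^ 'd) \<times> nat) measure)"
    and P_supp: "measure P (X \<times> {1..c}) = 1"
    and S_cont: "continuous_on (X \<times> X) (\<lambda>(x, t). S x t)"
    and S_sym: "\<forall>x\<in>X. \<forall>t\<in>X. S x t = S t x"
    and S_range: "\<forall>x\<in>X. \<forall>t\<in>X. 0 \<le> S x t \<and> S x t \<le> 1"
    and phi_meas: "\<forall>k\<in>K. phi k \<in> borel_measurable borel"
    and phi_sq: "\<forall>k\<in>K. set_integrable lborel X (\<lambda>t. (phi k t)\<^sup>2)"
    and phi_orth: "\<forall>j\<in>K. \<forall>k\<in>K. (LINT t:X|lborel. phi j t * phi k t) = (if j = k then 1 else 0)"
    and phi_eigen: "\<forall>k\<in>K. \<forall>x\<in>X. (LINT t:X|lborel. S x t * phi k t) = lam k * phi k x"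
    and C_pos: "C > 0"
    and eig_summable: "\<forall>x\<in>X. summable (\<lambda>k. if k \<in> K then lam k * \<bar>phi k x\<bar>\<^sup>2 else 0)"
    and eig_bound: "\<forall>x\<in>X. (\<Sum>k. if k \<in> K then lam k * \<bar>phi k x\<bar>\<^sup>2 else 0) < C"
    and Splus_summable: "\<forall>x\<in>X. \<forall>t\<in>X.
          summable (\<lambda>k. if k \<in> K \<and> lam k \<ge> 0 then lam k * phi k x * phi k t else 0)"
    and Sminus_summable: "\<forall>x\<in>X. \<forall>t\<in>X.
          summable (\<lambda>k. if k \<in> K \<and> lam k < 0 then \<bar>lam k\<bar> * phi k x * phi k t else 0)"
    and S_decomp: "\<forall>x\<in>X. \<forall>t\<in>X. S x t = Splus lam phi K x t - Sminus lam phi K x t"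
    and Bp_pos: "Bp > 0" and Bm_pos: "Bm > 0" and R_pos: "R > 0"
    and Splus_diag: "\<forall>x\<in>X. \<bar>Splus lam phi K x x\<bar> \<le> R\<^sup>2"
    and Sminus_diag: "\<forall>x\<in>X. \<bar>Sminus lam phi K x x\<bar> \<le> R\<^sup>2"
    and gamma_pos: "\<gamma> > 0"
    and delta: "0 < \<delta>" "\<delta> < 1"
  shows "(\<exists>E \<in> sets (PiM {..<n} (\<lambda>_. P)).
            measure (PiM {..<n} (\<lambda>_. P)) E \<ge> 1 - \<delta> \<and>
            (\<forall>s\<in>E. \<forall>\<alpha> :: nat \<Rightarrow> real.
               (\<forall>i<n. \<alpha> i \<ge> 0) \<longrightarrow> (\<Sum>i<n. \<alpha> i) = 1 \<longrightarrow>
               Omega (Splus lam phi K) c \<alpha> n s \<le> Bp\<^sup>2 \<longrightarrow>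
               Omega (Sminus lam phi K) c \<alpha> n s \<le> Bm\<^sup>2 \<longrightarrow>
               true_risk P (fS c S \<alpha> n s)
                 \<le> emp_margin_risk c \<gamma> S \<alpha> n s
                   + 8 * R * (2 * real c - 1) * real c * (Bp + Bm) / (\<gamma> * sqrt (real n))
                   + (16 * real c * (2 * real c - 1) * (Bp + Bm) * R\<^sup>2 / \<gamma> + 1)
                     * sqrt (ln (4 / \<delta>) / (2 * real n))))
         \<and> (\<gamma> \<ge> 1 \<longrightarrow>
            (\<forall>s :: nat \<Rightarrow> (real ^ 'd) \<times> nat. \<forall>\<alpha> :: nat \<Rightarrow> real.
               (\<forall>i<n. s i \<in> X \<times> {1..c}) \<longrightarrow>
               (\<forall>i<n. \<alpha> i \<ge> 0) \<longrightarrow> (\<Sum>i<n. \<alpha> i) = 1 \<longrightarrow>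
               emp_margin_risk c \<gamma> S \<alpha> n s
                 \<le> 1 - (1 / (real n * \<gamma>)) * (\<Sum>i<n. \<Sum>j<n.
                          (\<alpha> i + \<alpha> j) / 2 * S (fst (s i)) (fst (s j)))
                     + (1 / (real n * \<gamma>)) * (\<Sum>i<n. \<Sum>j<n.
                          if i < j \<and> snd (s i) \<noteq> snd (s j)
                          then 2 * (\<alpha> i + \<alpha> j) * S (fst (s i)) (fst (s j)) else 0)))"
proof (intro conjI impI allI)
  \<comment> \<open>Cutting off outside \<open>K\<close> and \<open>X\<close> makes every feature
    Borel on the whole space and pads the index set to all naturals.\<close>
  define \<psi> where "\<psi> = (\<lambda>k x. if k \<in> K \<and> x \<in> X then sqrt \<bar>lam k\<bar> * phi k x else 0)"
  define E2 where "E2 = {s \<in> space (iid P n). \<forall>i\<in>{..<n}. s i \<in> X \<times> {1..c}}"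
  have X_borel: "X \<in> sets borel"
    using X_compact by (simp add: borel_closed compact_imp_closed)
  have \<psi>_mult: "\<psi> k x * \<psi> k t = (if k \<in> K then \<bar>lam k\<bar> * phi k x * phi k t else 0)" if "x \<in> X" "t \<in> X" for k x t
    using that real_sqrt_mult_self[of "lam k"] by (simp add: \<psi>_def algebra_simps)
  interpret kernel_features X "Splus lam phi K" "Sminus lam phi K" "\<lambda>k. lam k \<ge> 0" \<psi>
  proof
    fix x t assume xt: "x \<in> X" "t \<in> X"
    have "(\<lambda>k. if lam k \<ge> 0 then \<psi> k x * \<psi> k t else 0) = (\<lambda>k. if k \<in> K \<and> lam k \<ge> 0 then lam k * phi k x * phi k t else 0)"
      by (auto simp: \<psi>_mult[OF xt])
    then show "(\<lambda>k. if lam k \<ge> 0 then \<psi> k x * \<psi> k t else 0) sums Splus lam phi K x t"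
      unfolding Splus_def using Splus_summable xt by (simp add: summable_sums)
    have "(\<lambda>k. if lam k \<ge> 0 then 0 else \<psi> k x * \<psi> k t) = (\<lambda>k. if k \<in> K \<and> lam k < 0 then \<bar>lam k\<bar> * phi k x * phi k t else 0)"
      by (auto simp: \<psi>_mult[OF xt])
    then show "(\<lambda>k. if lam k \<ge> 0 then 0 else \<psi> k x * \<psi> k t) sums Sminus lam phi K x t"
      unfolding Sminus_def using Sminus_summable xt by (simp add: summable_sums)
  qed (simp add: \<psi>_def)
  have \<psi>_meas: "\<psi> k \<in> borel_measurable borel" for k
  proof (cases "k \<in> K")
    case True
    then have [measurable]: "phi k \<in> borel_measurable borel" using phi_meas by blast
    show ?thesis
      unfolding \<psi>_def using X_borel by measurable
  qed (simp add: \<psi>_def)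
  have diag: "Splus lam phi K x x \<le> R\<^sup>2" "Sminus lam phi K x x \<le> R\<^sup>2" if "x \<in> X" for x
    using Splus_diag Sminus_diag that by (auto dest!: bspec)
  interpret margin_class P c n \<gamma> "Bp + Bm" "sqrt 2 * R" \<delta> \<psi>
  proof (intro margin_class.intro margin_class_axioms.intro)
    show "(\<Sum>k<N. (\<psi> k x)\<^sup>2) \<le> (sqrt 2 * R)\<^sup>2" for N x
      by (rule sum_square_features_le[OF diag])
  qed (use assms \<psi>_meas in auto)
  interpret N: prob_space "iid P n" by (rule prob_space_iid)
  obtain E1 where E1: "E1 \<in> sets (iid P n)" "1 - \<delta> \<le> measure (iid P n) E1"
    and E1_bound: "\<And>s N w. s \<in> E1 \<Longrightarrow> w \<in> weight_ball c (Bp + Bm) N \<Longrightarrow> bound_holds (score \<psi> N w) s"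
    using uniform_bound by blast
  have supp_event: "X \<times> {1..c} \<in> events"
    using P_supp measure_notin_sets by force
  have E2_sets: "E2 \<in> sets (iid P n)"
  proof -
    have "{s \<in> space (iid P n). s i \<in> X \<times> {1..c}} \<in> sets (iid P n)" if "i \<in> {..<n}" for i
      using measurable_sets[OF measurable_component_singleton[OF that, of "\<lambda>_. P"] supp_event]
      by (simp add: vimage_def Int_def conj_commute)
    then show ?thesis
      unfolding E2_def by (rule sets.sets_Collect_finite_All[OF _ finite_lessThan])
  qed
  have "AE p in P. p \<in> X \<times> {1..c}"
    using P_supp prob_eq_1[OF supp_event] by simp
  then have "AE s in iid P n. s i \<in> X \<times> {1..c}" if "i \<in> {..<n}" for i
    using that P_prob by (intro AE_PiM_component) auto
  then have "AE s in iid P n. \<forall>i\<in>{..<n}. s i \<in> X \<times> {1..c}"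
    by (rule AE_finite_allI[OF finite_lessThan])
  \<comment> \<open>Restricting to samples that lie in \<open>X\<close> with labels 1 to c removes
    only a null set, so the confidence of \<open>E1\<close> is retained.\<close>
  then have "AE s in iid P n. s \<in> E1 \<inter> E2 \<longleftrightarrow> s \<in> E1"
    using AE_space by eventually_elim (auto simp: E2_def)
  then have E_prob: "measure (iid P n) (E1 \<inter> E2) = measure (iid P n) E1"
    using E1(1) E2_sets by (intro measure_eq_AE) auto
  have slack_le: "slack \<le> 8 * R * (2 * real c - 1) * real c * (Bp + Bm) / (\<gamma> * sqrt (real n))
      + (16 * real c * (2 * real c - 1) * (Bp + Bm) * R\<^sup>2 / \<gamma> + 1) * sqrt (ln (4 / \<delta>) / (2 * real n))"
  proof -
    \<comment> \<open>The comparison rests on \<open>2 * sqrt 2 \<le> 8 * (2 * c - 1)\<close>, on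
      \<open>ln (1 / \<delta>) \<le> ln (4 / \<delta>)\<close>, and on the coefficient of the second
      root being at least 1.\<close>
    have c1: "2 * real c - 1 \<ge> 1" using c_ge by simp
    have "sqrt 2 \<le> 2"
      by (rule real_le_lsqrt) auto
    then have "2 * sqrt 2 \<le> 2 * 2"
      by (rule mult_left_mono) simp
    also have "\<dots> \<le> 8 * (2 * real c - 1)"
      using mult_left_mono[OF c1, of 8] by simp
    finally have "(2 * sqrt 2) * (R * real c * (Bp + Bm) / (\<gamma> * sqrt (real n)))
        \<le> (8 * (2 * real c - 1)) * (R * real c * (Bp + Bm) / (\<gamma> * sqrt (real n)))"
      using R_pos Bp_pos Bm_pos gamma_pos by (intro mult_right_mono) auto
    then have 1: "2 * real c * (sqrt 2 * R) * (Bp + Bm) / (\<gamma> * sqrt (real n))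
        \<le> 8 * R * (2 * real c - 1) * real c * (Bp + Bm) / (\<gamma> * sqrt (real n))"
      by (simp add: mult_ac)
    have "ln (1 / \<delta>) \<le> ln (4 / \<delta>)"
      using delta by (subst ln_le_cancel_iff) (auto simp: divide_right_mono)
    then have "sqrt (ln (1 / \<delta>) / (2 * real n)) \<le> 1 * sqrt (ln (4 / \<delta>) / (2 * real n))"
      by (simp add: divide_right_mono)
    also have "\<dots> \<le> (16 * real c * (2 * real c - 1) * (Bp + Bm) * R\<^sup>2 / \<gamma> + 1) * sqrt (ln (4 / \<delta>) / (2 * real n))"
      using c1 Bp_pos Bm_pos gamma_pos delta by (intro mult_right_mono) auto
    finally show ?thesis
      using 1 by (simp add: slack_def)
  qed
  show "\<exists>E \<in> sets (PiM {..<n} (\<lambda>_. P)).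
            measure (PiM {..<n} (\<lambda>_. P)) E \<ge> 1 - \<delta> \<and>
            (\<forall>s\<in>E. \<forall>\<alpha> :: nat \<Rightarrow> real.
               (\<forall>i<n. \<alpha> i \<ge> 0) \<longrightarrow> (\<Sum>i<n. \<alpha> i) = 1 \<longrightarrow>
               Omega (Splus lam phi K) c \<alpha> n s \<le> Bp\<^sup>2 \<longrightarrow>
               Omega (Sminus lam phi K) c \<alpha> n s \<le> Bm\<^sup>2 \<longrightarrow>
               true_risk P (fS c S \<alpha> n s)
                 \<le> emp_margin_risk c \<gamma> S \<alpha> n s
                   + 8 * R * (2 * real c - 1) * real c * (Bp + Bm) / (\<gamma> * sqrt (real n))
                   + (16 * real c * (2 * real c - 1) * (Bp + Bm) * R\<^sup>2 / \<gamma> + 1)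
                     * sqrt (ln (4 / \<delta>) / (2 * real n)))"
  proof (intro bexI[of _ "E1 \<inter> E2"] conjI ballI allI impI)
    show "E1 \<inter> E2 \<in> sets (iid P n)" using E1(1) E2_sets by blast
    show "1 - \<delta> \<le> measure (iid P n) (E1 \<inter> E2)" using E1(2) E_prob by simp
  next
    fix s and \<alpha> :: "nat \<Rightarrow> real"
    assume s: "s \<in> E1 \<inter> E2"
      and Om: "Omega (Splus lam phi K) c \<alpha> n s \<le> Bp\<^sup>2" "Omega (Sminus lam phi K) c \<alpha> n s \<le> Bm\<^sup>2"
    \<comment> \<open>The cut-off scores are the pointwise limits of Borel scores and hence Borel.
      They agree with \<open>hS\<close> on \<open>X\<close>, which carries almost all of
      \<open>P\<close> and every point of the sample.\<close>
    define h where "h = (\<lambda>x y. if x \<in> X then hS S \<alpha> n s x y else 0)"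
    have sX: "s i \<in> X \<times> {1..c}" if "i < n" for i
      using s that by (simp add: E2_def)
    then have sX': "fst (s i) \<in> X" if "i < n" for i
      using that by (simp add: mem_Times_iff)
    have w: "weights \<alpha> n s \<in> weight_ball c (Bp + Bm) N" for N
      using Bp_pos Bm_pos by (intro weights_in_ball sX' Om) auto
    have lim: "(\<lambda>N. score \<psi> N (weights \<alpha> n s) x y) \<longlonglongrightarrow> h x y" for x y
      unfolding h_def using S_decomp by (intro score_weights_tendsto sX') auto
    have h_meas: "(\<lambda>x. h x y) \<in> borel_measurable borel" for y
      using lim by (rule borel_measurable_LIMSEQ_real) (rule score_measurable[OF \<psi>_meas])
    have "true_risk P (fS c S \<alpha> n s) \<le> (\<integral>p. margin_loss c \<gamma> h p \<partial>P)"
      using c_ge by (intro true_risk_le_margin_loss[OF P_prob P_supp _ gamma_pos margin_loss_measurable[OF P_sets h_meas]])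
        (auto simp: h_def)
    also have "\<dots> \<le> 1 / real n * (\<Sum>i<n. margin_loss c \<gamma> h (s i)) + slack"
      using bound_holds_limit[OF w lim E1_bound, of s] s unfolding bound_holds_def by blast
    also have "1 / real n * (\<Sum>i<n. margin_loss c \<gamma> h (s i)) = emp_margin_risk c \<gamma> S \<alpha> n s"
      by (rule emp_margin_risk_eq[symmetric, where X = X]) (use sX in \<open>auto simp: h_def\<close>)
    finally show "true_risk P (fS c S \<alpha> n s)
        \<le> emp_margin_risk c \<gamma> S \<alpha> n s
          + 8 * R * (2 * real c - 1) * real c * (Bp + Bm) / (\<gamma> * sqrt (real n))
          + (16 * real c * (2 * real c - 1) * (Bp + Bm) * R\<^sup>2 / \<gamma> + 1)
            * sqrt (ln (4 / \<delta>) / (2 * real n))"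
      using slack_le by linarith
  qed
next
  fix s :: "nat \<Rightarrow> (real ^ 'd) \<times> nat" and \<alpha> :: "nat \<Rightarrow> real"
  assume "\<gamma> \<ge> 1" "\<forall>i<n. s i \<in> X \<times> {1..c}" "\<forall>i<n. \<alpha> i \<ge> 0" "(\<Sum>i<n. \<alpha> i) = 1"
  then show "emp_margin_risk c \<gamma> S \<alpha> n s
      \<le> 1 - (1 / (real n * \<gamma>)) * (\<Sum>i<n. \<Sum>j<n. (\<alpha> i + \<alpha> j) / 2 * S (fst (s i)) (fst (s j)))
        + (1 / (real n * \<gamma>)) * (\<Sum>i<n. \<Sum>j<n.
            if i < j \<and> snd (s i) \<noteq> snd (s j) then 2 * (\<alpha> i + \<alpha> j) * S (fst (s i)) (fst (s j)) else 0)"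
    using S_sym S_range by (intro emp_margin_risk_le[OF c_ge n_pos, where X = X]) auto
qed

end
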